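(* Let $\mathbb{P}_{\Delta}$ be a complete simplicial toric variety of dimension $n$, with homogeneous coordinates $z_1,\ldots,z_{n+r}$. Let $\omega$ be a nonzero integrable global section of $\Omega^1_{\mathbb{P}_{\Delta}}(d)$, $d=\sum_{i=1}^{n+r} d_i[D_i]$ (integrable: $\omega\wedge d\omega=0$), viewed as a polynomial $1$-form in homogeneous coordinates, whose singular scheme has codimension greater than $1$. Suppose there exists a radial vector field $R=\sum_{i} a_i z_i\frac{\partial}{\partial z_i}$ on $\mathbb{P}_{\Delta}$ such that $\sum_{i} a_i d_i\neq 0$. Then the singular set $\{p\in\mathbb{C}^{n+r}:\omega(p)=0\}$ of $\omega$ has at least one irreducible component of codimension two.
   Context: Let $\Delta$ be a complete simplicial fan in $N_{\mathbb{R}}$, $N\simeq\mathbb{Z}^n$, with rays $\rho_1,\ldots,\rho_{n+r}$ and primitive ray generators $n_1,\ldots,n_{n+r}\in N$. Let $D_i$ be the torus-invariant prime divisor of $\rho_i$, and let $r$ be the rank of the Weil divisor class group $\mathcal{A}_{n-1}(\mathbb{P}_{\Delta})$. The homogeneous coordinate ring is $\mathrm{S}=\mathbb{C}[z_1,\ldots,z_{n+r}]$, graded by $\mathcal{A}_{n-1}(\mathbb{P}_{\Delta})$ with $\deg z_i=[D_i]$; $\mathrm{S}_\alpha$ denotes the degree $\alpha$ part. One has $\mathbb{P}_{\Delta}=(\mathbb{C}^{n+r}-\mathcal{Z})/G$, where $G=\mathrm{Hom}_{\mathbb{Z}}(\mathcal{A}_{n-1}(\mathbb{P}_{\Delta}),\mathbb{C}^*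 )$ and $\mathcal{Z}$ is the common zero set of the monomials $\prod_{\rho_i\not\prec\sigma} z_i$, $\sigma\in\Delta$. Radial vector fields: choose $r$ linearly independent integer relations $\sum_{j}a_{ij}n_j=0$, $i=1,\ldots,r$; the radial vector fields are $R_i=\sum_j a_{ij}z_j\frac{\partial}{\partial z_j}$. They are tangent to the orbits of $G$ and span $\mathrm{Lie}(G)$. For a Cartier divisor $\sum_i d_iD_i$, put $d=\sum_i d_i[D_i]$ and $\Omega^1_{\mathbb{P}_{\Delta}}(d)=\Omega^1_{\mathbb{P}_{\Delta}}\otimes\mathcal{O}_{\mathbb{P}_{\Delta}}(\sum_i d_iD_i)$, where $\Omega^1_{\mathbb{P}_{\Delta}}$ is the sheaf of Zariski $1$-forms. In homogeneous coordinates a global section is a polynomial form $\omega=\sum_{i=1}^{n+r}P_i\,dz_i$ with $P_i\in\mathrm{S}_{d-[D_i]}$ and $i_R\omega=0$ for all $R\in\mathrm{Lie}(G)$. *)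

theory Defs
  imports
    "HOL-Analysis.Analysis"
    "HOL-Algebra.Coset"
    "HOL-Library.Poly_Mapping"
    "HOL-Library.Extended_Nat"
begin

section \<open>Complete simplicial fans\<close>

text \<open>
  The lattice \<open>N\<close> and its dual \<open>M\<close> are both \<open>int ^ 'n\<close>, paired by \<open>pairing\<close>, and
  \<open>N\<^sub>\<real>\<close> is \<open>real ^ 'n\<close>; the dimension is \<open>n = CARD('n)\<close>. The rays are indexed by a finite
  type \<open>'k\<close>, so that \<open>CARD('k) = n + r\<close>.
\<close>

definition real_vec :: "int ^ 'n \<Rightarrow> real ^ 'n" where
  "real_vec v = (\<chi> j. real_of_int (v $ j))"

definition pairing :: "int ^ 'n \<Rightarrow> int ^ 'n \<Rightarrow> int" where
  "pairing m v = (\<Sum>j\<in>UNIV. m $ j * v $ j)"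

definition rational_polyhedral_cone :: "(real ^ 'n) set \<Rightarrow> bool" where
  "rational_polyhedral_cone \<sigma> \<longleftrightarrow> (\<exists>F. finite F \<and> \<sigma> = convex_cone hull (real_vec ` F))"

definition strongly_convex_cone :: "(real ^ 'n) set \<Rightarrow> bool" where
  "strongly_convex_cone \<sigma> \<longleftrightarrow> \<sigma> \<inter> uminus ` \<sigma> = {0}"

definition cone_face :: "(real ^ 'n) set \<Rightarrow> (real ^ 'n) set \<Rightarrow> bool" where
  "cone_face \<tau> \<sigma> \<longleftrightarrow> (\<exists>m. (\<forall>x\<in>\<sigma>. 0 \<le> m \<bullet> x) \<and> \<tau> = {x \<in> \<sigma>. m \<bullet> x = 0})"

definition fan :: "(real ^ 'n) set set \<Rightarrow> bool" where
  "fan \<Delta> \<longleftrightarrow> finite \<Delta> \<and> \<Delta> \<noteq> {} \<and>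
    (\<forall>\<sigma>\<in>\<Delta>. rational_polyhedral_cone \<sigma> \<and> strongly_convex_cone \<sigma>) \<and>
    (\<forall>\<sigma>\<in>\<Delta>. \<forall>\<tau>. cone_face \<tau> \<sigma> \<longrightarrow> \<tau> \<in> \<Delta>) \<and>
    (\<forall>\<sigma>\<in>\<Delta>. \<forall>\<tau>\<in>\<Delta>. cone_face (\<sigma> \<inter> \<tau>) \<sigma> \<and> cone_face (\<sigma> \<inter> \<tau>) \<tau>)"

definition complete_fan :: "(real ^ 'n) set set \<Rightarrow> bool" where
  "complete_fan \<Delta> \<longleftrightarrow> fan \<Delta> \<and> \<Union>\<Delta> = UNIV"

definition simplicial_fan :: "(real ^ 'n) set set \<Rightarrow> bool" where
  "simplicial_fan \<Delta> \<longleftrightarrow> fan \<Delta> \<and> (\<forall>\<sigma>\<in>\<Delta>. \<exists>B. independent B \<and> \<sigma> = convex_cone hull B)"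

definition rays :: "(real ^ 'n) set set \<Rightarrow> (real ^ 'n) set set" where
  "rays \<Delta> = {\<rho> \<in> \<Delta>. dim \<rho> = 1}"

definition primitive_generator :: "(real ^ 'n) set \<Rightarrow> int ^ 'n \<Rightarrow> bool" where
  "primitive_generator \<rho> v \<longleftrightarrow> {w. real_vec w \<in> \<rho>} = {int k *s v | k. True}"

definition ray_generators ::
  "(real ^ 'n) set set \<Rightarrow> ('k \<Rightarrow> (real ^ 'n) set) \<Rightarrow> ('k \<Rightarrow> int ^ 'n) \<Rightarrow> bool" where
  "ray_generators \<Delta> \<rho> u \<longleftrightarrow>
    bij_betw \<rho> UNIV (rays \<Delta>) \<and> (\<forall>i. primitive_generator (\<rho> i) (u i))"


section \<open>Torus-invariant divisors and the class group\<close>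

text \<open>
  A torus-invariant Weil divisor \<open>\<Sum>\<^sub>i d\<^sub>i D\<^sub>i\<close> is the vector \<open>d :: int ^ 'k\<close>. By the exact
  sequence \<open>M \<rightarrow> \<int>\<^sup>n\<^sup>+\<^sup>r \<rightarrow> A\<^sub>n\<^sub>-\<^sub>1 \<rightarrow> 0\<close> the class group is the quotient by the divisors
  \<open>div (\<chi>\<^sup>m) = \<Sum>\<^sub>i \<langle>m, n\<^sub>i\<rangle> D\<^sub>i\<close> of characters.
\<close>

definition inv_divisors :: "(int ^ 'k) monoid" where
  "inv_divisors = \<lparr>carrier = UNIV, mult = (+), one = 0\<rparr>"

definition prime_div :: "'k \<Rightarrow> int ^ 'k" where
  "prime_div i = axis i 1"

definition char_div :: "('k::finite \<Rightarrow> int ^ 'n) \<Rightarrow> int ^ 'n \<Rightarrow> int ^ 'k" where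
  "char_div u m = (\<chi> i. pairing m (u i))"

definition class_group :: "('k::finite \<Rightarrow> int ^ 'n) \<Rightarrow> (int ^ 'k) set monoid" where
  "class_group u = inv_divisors Mod (range (char_div u))"

definition div_class :: "('k::finite \<Rightarrow> int ^ 'n) \<Rightarrow> int ^ 'k \<Rightarrow> (int ^ 'k) set" where
  "div_class u D = range (char_div u) #>\<^bsub>inv_divisors\<^esub> D"

text \<open>
  Cartier means principal on every affine chart \<open>U\<^sub>\<sigma>\<close>; for a torus-invariant divisor a local
  equation on \<open>U\<^sub>\<sigma>\<close> can be taken to be a character \<open>\<chi>\<^sup>m\<close>, and \<open>D\<^sub>i\<close> meets \<open>U\<^sub>\<sigma>\<close> iff \<open>\<rho>\<^sub>i\<close> is a
  face of \<open>\<sigma>\<close>.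
\<close>

definition cartier_divisor ::
  "(real ^ 'n) set set \<Rightarrow> ('k \<Rightarrow> (real ^ 'n) set) \<Rightarrow> ('k \<Rightarrow> int ^ 'n) \<Rightarrow> int ^ 'k \<Rightarrow> bool" where
  "cartier_divisor \<Delta> \<rho> u D \<longleftrightarrow>
    (\<forall>\<sigma>\<in>\<Delta>. \<exists>m. \<forall>i. cone_face (\<rho> i) \<sigma> \<longrightarrow> D $ i = pairing m (u i))"


section \<open>The group \<open>G\<close>, its Lie algebra, and radial vector fields\<close>

definition complex_units :: "complex monoid" where
  "complex_units = \<lparr>carrier = - {0}, mult = (*), one = 1\<rparr>"

text \<open>\<open>G = Hom(A\<^sub>n\<^sub>-\<^sub>1, \<complex>\<^sup>*)\<close>, embedded in the torus \<open>(\<complex>\<^sup>*)\<^sup>n\<^sup>+\<^sup>r\<close> by \<open>\<phi> \<mapsto> (\<phi> [D\<^sub>i])\<^sub>i\<close>.\<close>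

definition cox_group :: "('k::finite \<Rightarrow> int ^ 'n) \<Rightarrow> (complex ^ 'k) set" where
  "cox_group u = {(\<chi> i. \<phi> (div_class u (prime_div i))) | \<phi>. \<phi> \<in> hom (class_group u) complex_units}"

text \<open>
  The element \<open>a\<close> of \<open>Lie (\<complex>\<^sup>*)\<^sup>n\<^sup>+\<^sup>r = \<complex>\<^sup>n\<^sup>+\<^sup>r\<close> corresponds to the vector field
  \<open>\<Sum>\<^sub>i a\<^sub>i z\<^sub>i \<partial>/\<partial>z\<^sub>i\<close>.
\<close>

definition lie_cox_group :: "('k::finite \<Rightarrow> int ^ 'n) \<Rightarrow> (complex ^ 'k) set" where
  "lie_cox_group u = {a. \<forall>s. (\<chi> i. exp (s * a $ i)) \<in> cox_group u}"

definition ray_relation :: "('k::finite \<Rightarrow> int ^ 'n) \<Rightarrow> int ^ 'k \<Rightarrow> bool" where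
  "ray_relation u b \<longleftrightarrow> (\<Sum>j\<in>UNIV. b $ j *s u j) = 0"

text \<open>
  Coefficient vectors of the radial vector fields. Any maximal linearly independent family of
  integer relations has the same span as all of them, so no choice of such a family is needed. By
  \<open>lie_cox_group_eq_radial_coeffs\<close> below, this span is \<open>Lie G\<close>.
\<close>

definition radial_coeffs :: "('k::finite \<Rightarrow> int ^ 'n) \<Rightarrow> (complex ^ 'k) set" where
  "radial_coeffs u = vec.span {(\<chi> j. of_int (b $ j)) | b. ray_relation u b}"


section \<open>The homogeneous coordinate ring\<close>

type_synonym 'k cpoly = "('k \<Rightarrow>\<^sub>0 nat) \<Rightarrow>\<^sub>0 complex"

definition poly_eval :: "'k::finite cpoly \<Rightarrow> complex ^ 'k \<Rightarrow> complex" where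
  "poly_eval p z = (\<Sum>e\<in>Poly_Mapping.keys p.
     Poly_Mapping.lookup p e * (\<Prod>i\<in>UNIV. z $ i ^ Poly_Mapping.lookup e i))"

text \<open>When \<open>z\<^sub>i\<close> does not occur in the monomial \<open>e\<close>, the subtraction truncates, but the coefficient vanishes.\<close>

definition partial :: "'k \<Rightarrow> 'k cpoly \<Rightarrow> 'k cpoly" where
  "partial i p = (\<Sum>e\<in>Poly_Mapping.keys p.
     Poly_Mapping.single (e - Poly_Mapping.single i 1)
       (of_nat (Poly_Mapping.lookup e i) * Poly_Mapping.lookup p e))"

definition monomial_degree ::
  "('k::finite \<Rightarrow> int ^ 'n) \<Rightarrow> ('k \<Rightarrow>\<^sub>0 nat) \<Rightarrow> (int ^ 'k) set" where
  "monomial_degree u e = div_class u (\<chi> i. int (Poly_Mapping.lookup e i))"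

definition graded_part ::
  "('k::finite \<Rightarrow> int ^ 'n) \<Rightarrow> (int ^ 'k) set \<Rightarrow> 'k cpoly set" where
  "graded_part u \<alpha> = {p. \<forall>e\<in>Poly_Mapping.keys p. monomial_degree u e = \<alpha>}"


section \<open>Polynomial one-forms\<close>

text \<open>
  A 1-form \<open>\<Sum>\<^sub>i P\<^sub>i dz\<^sub>i\<close> is the vector of its coefficients. A 2-form
  \<open>\<Sum>\<^sub>i\<^sub><\<^sub>j \<beta>\<^sub>i\<^sub>j dz\<^sub>i \<and> dz\<^sub>j\<close> is its antisymmetric coefficient function, and likewise for 3-forms.
\<close>

definition ext_deriv :: "'k::finite cpoly ^ 'k \<Rightarrow> 'k \<Rightarrow> 'k \<Rightarrow> 'k cpoly" where
  "ext_deriv \<omega> i j = partial i (\<omega> $ j) - partial j (\<omega> $ i)"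

definition wedge12 ::
  "'k::finite cpoly ^ 'k \<Rightarrow> ('k \<Rightarrow> 'k \<Rightarrow> 'k cpoly) \<Rightarrow> 'k \<Rightarrow> 'k \<Rightarrow> 'k \<Rightarrow> 'k cpoly" where
  "wedge12 \<omega> \<beta> i j l = \<omega> $ i * \<beta> j l - \<omega> $ j * \<beta> i l + \<omega> $ l * \<beta> i j"

definition integrable_form :: "'k::finite cpoly ^ 'k \<Rightarrow> bool" where
  "integrable_form \<omega> \<longleftrightarrow> (\<forall>i j l. wedge12 \<omega> (ext_deriv \<omega>) i j l = 0)"

text \<open>Contraction with the vector field \<open>\<Sum>\<^sub>i a\<^sub>i z\<^sub>i \<partial>/\<partial>z\<^sub>i\<close>.\<close>

definition contract_diag :: "complex ^ 'k \<Rightarrow> 'k::finite cpoly ^ 'k \<Rightarrow> 'k cpoly" where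
  "contract_diag a \<omega> =
    (\<Sum>i\<in>UNIV. Poly_Mapping.single (Poly_Mapping.single i 1) (a $ i) * \<omega> $ i)"

text \<open>Global sections of \<open>\<Omega>\<^sup>1(d)\<close>, \<open>d = \<Sum>\<^sub>i d\<^sub>i [D\<^sub>i]\<close>, in homogeneous coordinates.\<close>

definition form_sections :: "('k::finite \<Rightarrow> int ^ 'n) \<Rightarrow> int ^ 'k \<Rightarrow> ('k cpoly ^ 'k) set" where
  "form_sections u d = {\<omega>.
     (\<forall>i. \<omega> $ i \<in> graded_part u
        (div_class u d \<otimes>\<^bsub>class_group u\<^esub> inv\<^bsub>class_group u\<^esub> div_class u (prime_div i))) \<and>
     (\<forall>a\<in>lie_cox_group u. contract_diag a \<omega> = 0)}"

definition singular_set :: "'k::finite cpoly ^ 'k \<Rightarrow> (complex ^ 'k) set" where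
  "singular_set \<omega> = {p. \<forall>i. poly_eval (\<omega> $ i) p = 0}"


section \<open>Zariski closed subsets of affine space\<close>

definition zariski_closed :: "(complex ^ 'k::finite) set \<Rightarrow> bool" where
  "zariski_closed V \<longleftrightarrow> (\<exists>F. V = {z. \<forall>p\<in>F. poly_eval p z = 0})"

definition irreducible_closed :: "(complex ^ 'k::finite) set \<Rightarrow> bool" where
  "irreducible_closed Y \<longleftrightarrow> zariski_closed Y \<and> Y \<noteq> {} \<and>
    (\<forall>A B. zariski_closed A \<and> zariski_closed B \<and> Y = A \<union> B \<longrightarrow> Y = A \<or> Y = B)"

definition irreducible_component ::
  "(complex ^ 'k::finite) set \<Rightarrow> (complex ^ 'k) set \<Rightarrow> bool" where
  "irreducible_component Y V \<longleftrightarrow> irreducible_closed Y \<and> Y \<subseteq> V \<and>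
    (\<forall>Y'. irreducible_closed Y' \<and> Y \<subseteq> Y' \<and> Y' \<subseteq> V \<longrightarrow> Y' = Y)"

definition irreducible_codim :: "(complex ^ 'k::finite) set \<Rightarrow> enat" where
  "irreducible_codim Y = Sup {enat m | m. \<exists>C :: nat \<Rightarrow> (complex ^ 'k) set.
     C 0 = Y \<and> (\<forall>i\<le>m. irreducible_closed (C i)) \<and> (\<forall>i<m. C i \<subset> C (Suc i))}"

text \<open>The empty set has codimension \<open>\<infinity>\<close>.\<close>

definition zariski_codim :: "(complex ^ 'k::finite) set \<Rightarrow> enat" where
  "zariski_codim V = Inf {irreducible_codim Y | Y. irreducible_closed Y \<and> Y \<subseteq> V}"


section \<open>The radial vector fields span \<open>Lie G\<close>\<close>

lemma group_inv_divisors: "comm_group (inv_divisors :: (int ^ 'k::finite) monoid)"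
proof (rule comm_groupI)
  fix x :: "int ^ 'k"
  show "\<exists>y\<in>carrier inv_divisors. y \<otimes>\<^bsub>inv_divisors\<^esub> x = \<one>\<^bsub>inv_divisors\<^esub>"
    by (rule bexI[of _ "-x"]) (auto simp: inv_divisors_def)
qed (auto simp: inv_divisors_def algebra_simps)

lemma pairing_add: "pairing (m + m') v = pairing m v + pairing m' v"
  by (simp add: pairing_def algebra_simps sum.distrib)

lemma normal_char_div:
  "range (char_div u) \<lhd> (inv_divisors :: (int ^ 'k::finite) monoid)"
proof -
  interpret comm_group "inv_divisors :: (int ^ 'k) monoid" by (rule group_inv_divisors)
  have inv_eq: "inv\<^bsub>inv_divisors\<^esub> x = - x" for x :: "int ^ 'k"
    by (rule inv_equality) (auto simp: inv_divisors_def)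
  have add: "char_div u m + char_div u m' = char_div u (m + m')" for m m'
    by (simp add: char_div_def vec_eq_iff pairing_add)
  have "subgroup (range (char_div u)) inv_divisors"
  proof (rule subgroupI)
    fix a assume "a \<in> range (char_div u)"
    then obtain m where "a = char_div u m" by auto
    then have "- a = char_div u (- m)"
      by (simp add: char_div_def vec_eq_iff pairing_def sum_negf)
    then show "inv\<^bsub>inv_divisors\<^esub> a \<in> range (char_div u)" by (auto simp: inv_eq)
  next
    fix a b assume "a \<in> range (char_div u)" "b \<in> range (char_div u)"
    then show "a \<otimes>\<^bsub>inv_divisors\<^esub> b \<in> range (char_div u)"
      by (auto simp: inv_divisors_def add)
  qed (auto simp: inv_divisors_def)
  then show ?thesis by (rule subgroup_imp_normal)
qed

lemma div_class_eq_iff: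
  "div_class u D = div_class u E \<longleftrightarrow> (\<exists>m. D - E = char_div u m)" for D E :: "int ^ 'k::finite"
proof -
  interpret comm_group "inv_divisors :: (int ^ 'k) monoid" by (rule group_inv_divisors)
  have sg: "subgroup (range (char_div u)) inv_divisors"
    using normal_char_div by (rule normal_imp_subgroup)
  have mem: "x \<in> div_class u y \<longleftrightarrow> (\<exists>m. x = char_div u m + y)" for x y
    by (auto simp: div_class_def r_coset_def inv_divisors_def)
  have "div_class u D = div_class u E \<longleftrightarrow> D \<in> div_class u E"
    using rcos_self[OF _ sg, of D] repr_independence[OF _ _ sg, of D E]
    by (auto simp: div_class_def inv_divisors_def)
  then show ?thesis unfolding mem by (simp add: diff_eq_eq)
qed

lemma group_complex_units: "comm_group complex_units"
proof (rule comm_groupI)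
  fix x assume "x \<in> carrier complex_units"
  then show "\<exists>y\<in>carrier complex_units. y \<otimes>\<^bsub>complex_units\<^esub> x = \<one>\<^bsub>complex_units\<^esub>"
    by (intro bexI[of _ "inverse x"]) (auto simp: complex_units_def)
qed (auto simp: complex_units_def algebra_simps)

lemma hom_units_eq:
  fixes h :: "int ^ 'k::finite \<Rightarrow> complex"
  assumes nz: "\<And>x. h x \<noteq> 0" and add: "\<And>x y. h (x + y) = h x * h y"
  shows "h D = (\<Prod>i\<in>UNIV. h (axis i 1) powi (D $ i))"
proof -
  have h0: "h 0 = 1" using add[of 0 0] nz[of 0] by simp
  have hm: "h (- x) = inverse (h x)" for x
    using add[of "-x" x] nz[of x] by (simp add: h0 field_simps)
  have hn: "h (axis i (int k)) = h (axis i 1) ^ k" for i :: 'k and k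
  proof (induction k)
    case 0
    have "axis i 0 = (0 :: int ^ 'k)" by (simp add: vec_eq_iff axis_def)
    then show ?case by (simp only: of_nat_0 power_0 h0)
  next
    case (Suc k)
    have "axis i (int (Suc k)) = axis i 1 + (axis i (int k) :: int ^ 'k)"
      by (auto simp: vec_eq_iff axis_def)
    then show ?case using Suc by (simp add: add)
  qed
  have hz: "h (axis i c) = h (axis i 1) powi c" for i c
  proof (cases "c \<ge> 0")
    case True
    then show ?thesis using hn[of i "nat c"] by (simp add: power_int_def)
  next
    case False
    have "axis i c = - (axis i (int (nat (- c))) :: int ^ 'k)"
      using False by (auto simp: vec_eq_iff axis_def)
    then show ?thesis using False hn[of i "nat (-c)"]
      by (simp add: power_int_def hm power_inverse)
  qed
  have hs: "h (\<Sum>i\<in>I. f i) = (\<Prod>i\<in>I. h (f i))" if "finite I" for I :: "'k set" and f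
    using that by induction (auto simp: h0 add)
  have "D = (\<Sum>i\<in>UNIV. axis i (D $ i))"
    by (simp add: vec_eq_iff axis_def sum.delta)
  then have "h D = h (\<Sum>i\<in>UNIV. axis i (D $ i))" by (rule arg_cong)
  also have "\<dots> = (\<Prod>i\<in>UNIV. h (axis i (D $ i)))" by (simp add: hs)
  also have "\<dots> = (\<Prod>i\<in>UNIV. h (axis i 1) powi (D $ i))" by (intro prod.cong refl hz)
  finally show ?thesis .
qed

lemma cox_group_iff:
  "t \<in> cox_group u \<longleftrightarrow>
     (\<forall>i. t $ i \<noteq> 0) \<and> (\<forall>m. (\<Prod>i\<in>UNIV. t $ i powi pairing m (u i)) = 1)"
  for t :: "complex ^ 'k::finite"
proof -
  interpret D: comm_group "inv_divisors :: (int ^ 'k) monoid" by (rule group_inv_divisors)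
  interpret U: comm_group complex_units by (rule group_complex_units)
  interpret N: normal "range (char_div u)" "inv_divisors :: (int ^ 'k) monoid"
    by (rule normal_char_div)
  show ?thesis
  proof (intro iffI conjI)
    assume "t \<in> cox_group u"
    then obtain \<phi> where \<phi>: "\<phi> \<in> hom (class_group u) complex_units"
      and t: "\<And>i. t $ i = \<phi> (div_class u (axis i 1))"
      by (auto simp: cox_group_def prime_div_def)
    define h where "h = \<phi> \<circ> div_class u"
    have "div_class u \<in> hom inv_divisors (class_group u)"
      using N.r_coset_hom_Mod by (simp add: class_group_def div_class_def[abs_def])
    then have hh: "h \<in> hom inv_divisors complex_units"
      unfolding h_def using \<phi> by (rule hom_compose)
    have nz: "h x \<noteq> 0" for x
      using hom_in_carrier[OF hh, of x] by (auto simp: inv_divisors_def complex_units_def)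
    have add: "h (x + y) = h x * h y" for x y
      using hom_mult[OF hh, of x y] by (auto simp: inv_divisors_def complex_units_def)
    have h0: "h 0 = 1" using add[of 0 0] nz[of 0] by simp
    have ti: "t $ i = h (axis i 1)" for i by (simp add: t h_def)
    show "\<forall>i. t $ i \<noteq> 0" by (simp add: ti nz)
    show "\<forall>m. (\<Prod>i\<in>UNIV. t $ i powi pairing m (u i)) = 1"
    proof
      fix m
      have "div_class u (char_div u m) = div_class u 0" by (auto simp: div_class_eq_iff)
      then have "h (char_div u m) = h 0" by (simp add: h_def)
      then show "(\<Prod>i\<in>UNIV. t $ i powi pairing m (u i)) = 1"
        by (subst (asm) hom_units_eq[OF nz add]) (simp add: ti h0 char_div_def)
    qed
  next
    assume t: "(\<forall>i. t $ i \<noteq> 0) \<and> (\<forall>m. (\<Prod>i\<in>UNIV. t $ i powi pairing m (u i)) = 1)"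
    define h where "h D = (\<Prod>i\<in>UNIV. t $ i powi (D $ i))" for D :: "int ^ 'k"
    have add: "h (x + y) = h x * h y" for x y
      using t by (simp add: h_def power_int_add prod.distrib)
    have nz: "h x \<noteq> 0" for x using t by (simp add: h_def)
    have hh: "h \<in> hom inv_divisors complex_units"
      using nz by (auto simp: hom_def inv_divisors_def complex_units_def add)
    have "h x = h y" if "range (char_div u) #>\<^bsub>inv_divisors\<^esub> x = range (char_div u) #>\<^bsub>inv_divisors\<^esub> y" for x y
    proof -
      from that have "div_class u x = div_class u y" by (simp add: div_class_def)
      then obtain m where "x = char_div u m + y"
        unfolding div_class_eq_iff by (auto simp: diff_eq_eq)
      moreover have "h (char_div u m) = 1" using t by (simp add: h_def char_div_def)
      ultimately show ?thesis by (simp add: add)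
    qed
    with FactGroup_universal[OF hh normal_char_div[of u]] obtain g
      where g: "g \<in> hom (class_group u) complex_units" "\<And>x. g (div_class u x) = h x"
      unfolding class_group_def div_class_def
      by (metis (no_types, lifting) UNIV_I inv_divisors_def partial_object.select_convs(1))
    have "t = (\<chi> i. g (div_class u (prime_div i)))"
      unfolding g(2)
    proof (clarsimp simp: vec_eq_iff h_def prime_div_def)
      fix i
      have "(\<Prod>j\<in>UNIV. t $ j powi (axis i 1 $ j)) = (\<Prod>j\<in>UNIV. if j = i then t $ i else 1)"
        by (rule prod.cong) (auto simp: axis_def)
      then show "t $ i = (\<Prod>j\<in>UNIV. t $ j powi (axis i 1 $ j))" by simp
    qed
    with g(1) show "t \<in> cox_group u" unfolding cox_group_def by blast
  qed
qed

lemma lie_cox_group_iff: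
  "a \<in> lie_cox_group u \<longleftrightarrow> (\<forall>l. (\<Sum>i\<in>UNIV. a $ i * of_int (u i $ l)) = 0)"
  for a :: "complex ^ 'k::finite" and u :: "'k \<Rightarrow> int ^ 'n::finite"
proof -
  have prod: "(\<Prod>i\<in>UNIV. exp (s * a $ i) powi c i) = exp (s * (\<Sum>i\<in>UNIV. a $ i * of_int (c i)))"
    for s and c :: "'k \<Rightarrow> int"
  proof -
    have "(\<Prod>i\<in>UNIV. exp (s * a $ i) powi c i) = (\<Prod>i\<in>UNIV. exp (s * (a $ i * of_int (c i))))"
      by (intro prod.cong refl) (simp add: exp_power_int algebra_simps)
    then show ?thesis by (simp add: exp_sum sum_distrib_left)
  qed
  have "a \<in> lie_cox_group u \<longleftrightarrow>
      (\<forall>m s. exp (s * (\<Sum>i\<in>UNIV. a $ i * of_int (pairing m (u i)))) = 1)"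
    by (auto simp: lie_cox_group_def cox_group_iff prod)
  also have "\<dots> \<longleftrightarrow> (\<forall>m. (\<Sum>i\<in>UNIV. a $ i * of_int (pairing m (u i))) = 0)"
  proof -
    have "S = 0" if "\<forall>s. exp (s * S) = 1" for S :: complex
    proof (rule ccontr)
      assume "S \<noteq> 0"
      with spec[OF that, of "1 / S"] have "exp (1 :: complex) = 1" by simp
      then have "exp (1 :: real) = 1"
        by (metis exp_of_real of_real_1 of_real_eq_1_iff)
      then show False by simp
    qed
    then show ?thesis by auto
  qed
  also have "\<dots> \<longleftrightarrow> (\<forall>l. (\<Sum>i\<in>UNIV. a $ i * of_int (u i $ l)) = 0)"
  proof (intro iffI allI)
    fix l assume *: "\<forall>m. (\<Sum>i\<in>UNIV. a $ i * of_int (pairing m (u i))) = 0"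
    have "pairing (axis l 1) v = v $ l" for v :: "int ^ 'n"
      by (simp add: pairing_def axis_def if_distrib[of "\<lambda>x. x * _"] cong: if_cong)
    with spec[OF *, of "axis l 1"] show "(\<Sum>i\<in>UNIV. a $ i * of_int (u i $ l)) = 0" by simp
  next
    fix m :: "int ^ 'n" assume *: "\<forall>l. (\<Sum>i\<in>UNIV. a $ i * of_int (u i $ l)) = 0"
    have "(\<Sum>i\<in>UNIV. a $ i * of_int (pairing m (u i)))
        = (\<Sum>i\<in>UNIV. \<Sum>l\<in>UNIV. of_int (m $ l) * (a $ i * of_int (u i $ l)))"
      by (simp add: pairing_def sum_distrib_left algebra_simps)
    also have "\<dots> = (\<Sum>l\<in>UNIV. of_int (m $ l) * (\<Sum>i\<in>UNIV. a $ i * of_int (u i $ l)))"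
      by (subst sum.swap) (simp add: sum_distrib_left)
    finally show "(\<Sum>i\<in>UNIV. a $ i * of_int (pairing m (u i))) = 0" using * by simp
  qed
  finally show ?thesis .
qed

interpretation rat_complex: vector_space "\<lambda>q z. of_rat q * z :: complex"
  by unfold_locales (auto simp: algebra_simps of_rat_add of_rat_mult)

lemma lie_cox_group_eq_radial_coeffs:
  "lie_cox_group u = radial_coeffs u" for u :: "'k::finite \<Rightarrow> int ^ 'n::finite"
proof (intro equalityI subsetI)
  fix a :: "complex ^ 'k" assume "a \<in> radial_coeffs u"
  then have "\<forall>l. (\<Sum>i\<in>UNIV. a $ i * of_int (u i $ l)) = 0"
    unfolding radial_coeffs_def
  proof (induction rule: vec.span_induct_alt)
    case base then show ?case by simp
  next
    case (step c x y)
    then obtain b where b: "ray_relation u b" "x = (\<chi> j. of_int (b $ j))" by auto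
    show ?case
    proof
      fix l
      have "(\<Sum>j\<in>UNIV. b $ j * u j $ l) = 0"
        using b(1) by (simp add: ray_relation_def vec_eq_iff)
      then have "(\<Sum>j\<in>UNIV. of_int (b $ j) * of_int (u j $ l)) = (0 :: complex)"
        by (metis (mono_tags, lifting) of_int_0 of_int_mult of_int_sum sum.cong)
      moreover have "(\<Sum>i\<in>UNIV. (c *s x + y) $ i * of_int (u i $ l))
          = c * (\<Sum>j\<in>UNIV. of_int (b $ j) * of_int (u j $ l)) + (\<Sum>i\<in>UNIV. y $ i * of_int (u i $ l))"
        by (simp add: b(2) algebra_simps sum.distrib sum_distrib_left)
      ultimately show "(\<Sum>i\<in>UNIV. (c *s x + y) $ i * of_int (u i $ l)) = 0"
        using step by simp
    qed
  qed
  then show "a \<in> lie_cox_group u" by (simp add: lie_cox_group_iff)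
next
  fix a :: "complex ^ 'k" assume "a \<in> lie_cox_group u"
  then have a0: "(\<Sum>i\<in>UNIV. a $ i * of_int (u i $ l)) = 0" for l
    by (simp add: lie_cox_group_iff)
  obtain B where B: "B \<subseteq> range (($) a)" "rat_complex.independent B"
      "range (($) a) \<subseteq> rat_complex.span B"
    using rat_complex.maximal_independent_subset by blast
  have finB: "finite B" using B(1) by (rule finite_subset) simp
  have "\<exists>q. a $ i = (\<Sum>\<beta>\<in>B. of_rat (q \<beta>) * \<beta>)" for i
    using B(3) rat_complex.span_finite[OF finB] by blast
  then obtain q where q: "\<And>i. a $ i = (\<Sum>\<beta>\<in>B. of_rat (q i \<beta>) * \<beta>)" by metis
  have rel: "(\<Sum>i\<in>UNIV. q i \<beta> * of_int (u i $ l)) = 0" if "\<beta> \<in> B" for \<beta> l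
  proof -
    have "(\<Sum>\<beta>\<in>B. of_rat (\<Sum>i\<in>UNIV. q i \<beta> * of_int (u i $ l)) * \<beta>)
        = (\<Sum>\<beta>\<in>B. \<Sum>i\<in>UNIV. of_rat (q i \<beta>) * \<beta> * of_int (u i $ l))"
      by (simp add: of_rat_sum of_rat_mult sum_distrib_right sum_distrib_left algebra_simps)
    also have "\<dots> = (\<Sum>i\<in>UNIV. a $ i * of_int (u i $ l))"
      by (subst sum.swap) (simp add: q sum_distrib_right)
    finally have *: "(\<Sum>\<beta>\<in>B. of_rat (\<Sum>i\<in>UNIV. q i \<beta> * of_int (u i $ l)) * \<beta>) = 0"
      by (simp add: a0)
    show ?thesis
      by (rule rat_complex.independentD[OF B(2) finB subset_refl *  that])
  qed
  have memb: "(\<chi> i. of_rat (q i \<beta>)) \<in> radial_coeffs u" if "\<beta> \<in> B" for \<beta>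
  proof -
    define N where "N = (\<Prod>i\<in>UNIV. snd (quotient_of (q i \<beta>)))"
    have N: "N > 0" unfolding N_def by (rule prod_pos) (auto simp: quotient_of_denom_pos')
    have "\<exists>c. of_int N * q i \<beta> = of_int c" for i
    proof -
      have "snd (quotient_of (q i \<beta>)) dvd N" unfolding N_def by (rule dvd_prodI) auto
      then obtain k where k: "N = snd (quotient_of (q i \<beta>)) * k" by (auto elim: dvdE)
      have "q i \<beta> = of_int (fst (quotient_of (q i \<beta>))) / of_int (snd (quotient_of (q i \<beta>)))"
        using quotient_of_div[of "q i \<beta>"] by (metis prod.collapse)
      moreover have "snd (quotient_of (q i \<beta>)) \<noteq> 0" using quotient_of_denom_pos'[of "q i \<beta>"] by simp
      ultimately have "of_int N * q i \<beta> = of_int (fst (quotient_of (q i \<beta>)) * k)"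
        unfolding k by (simp add: field_simps)
      then show ?thesis by blast
    qed
    then obtain c where c: "\<And>i. of_int N * q i \<beta> = of_int (c i)" by metis
    define b where "b = (\<chi> i. c i)"
    have "ray_relation u b"
    proof -
      have "(\<Sum>j\<in>UNIV. c j * u j $ l) = 0" for l
      proof -
        have "rat_of_int (\<Sum>j\<in>UNIV. c j * u j $ l) = (\<Sum>j\<in>UNIV. of_int N * q j \<beta> * of_int (u j $ l))"
          by (simp add: c)
        also have "\<dots> = of_int N * (\<Sum>j\<in>UNIV. q j \<beta> * of_int (u j $ l))"
          by (simp add: sum_distrib_left algebra_simps)
        finally have "rat_of_int (\<Sum>j\<in>UNIV. c j * u j $ l) = 0" using rel[OF that] by simp
        then show ?thesis by (simp only: of_int_eq_0_iff)
      qed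
      then show ?thesis by (simp add: ray_relation_def b_def vec_eq_iff)
    qed
    then have "(\<chi> j. of_int (b $ j)) \<in> radial_coeffs u"
      unfolding radial_coeffs_def by (intro vec.span_base) auto
    then have "inverse (of_int N) *s (\<chi> j. of_int (b $ j)) \<in> radial_coeffs u"
      unfolding radial_coeffs_def by (rule vec.span_scale)
    moreover have "inverse (of_int N) *s (\<chi> j. of_int (b $ j)) = ((\<chi> i. of_rat (q i \<beta>)) :: complex ^ 'k)"
    proof (rule vec_eq_iff[THEN iffD2], rule allI)
      fix i
      have "of_rat (of_int N * q i \<beta>) = (of_rat (of_int (c i)) :: complex)" by (simp only: c)
      then show "(inverse (of_int N) *s (\<chi> j. of_int (b $ j))) $ i = ((\<chi> i. of_rat (q i \<beta>)) :: complex ^ 'k) $ i"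
        using N by (simp add: b_def of_rat_mult field_simps)
    qed
    ultimately show ?thesis by metis
  qed
  have "a = (\<Sum>\<beta>\<in>B. \<beta> *s (\<chi> i. of_rat (q i \<beta>)))"
    by (simp add: vec_eq_iff q algebra_simps)
  also have "\<dots> \<in> radial_coeffs u"
    unfolding radial_coeffs_def
    by (intro vec.span_sum vec.span_scale) (use memb in \<open>auto simp: radial_coeffs_def\<close>)
  finally show "a \<in> radial_coeffs u" .
qed

end

theory Submission
  imports Defs "HOL-Computational_Algebra.Fundamental_Theorem_Algebra"
begin

text \<open>
  By degree, \<open>i\<^sub>R d\<omega> = \<lambda> \<omega>\<close> with \<open>\<lambda> = \<Sum>\<^sub>i a\<^sub>i d\<^sub>i \<noteq> 0\<close>. If \<open>d\<omega> = \<omega> \<and> \<eta>\<close> for a polynomial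
  form \<open>\<eta>\<close>, then contraction with \<open>R\<close> gives \<open>\<lambda> = - i\<^sub>R \<eta>\<close>, which is absurd at the origin. So the
  division of \<open>d\<omega>\<close> by \<open>\<omega>\<close> must fail, and hence (de Rham--Saito) the ideal \<open>I\<close> of the coefficients of
  \<open>\<omega>\<close> has depth at most two.

  To get a component from this, compare \<open>I\<close> with the ring of polynomials invariant under translation
  along two vectors \<open>v\<close>, \<open>w\<close>. If \<open>I\<close> contains no nonzero invariant for some \<open>v\<close>, \<open>w\<close>, then a prime
  \<open>P \<supseteq> I\<close> with the same property has a zero set of codimension at most two, because the invariants
  have transcendence degree at least \<open>N - 2\<close>, \<open>N\<close> being the number of coordinates. Otherwise there are \<open>v\<close>, \<open>w\<close> and
  \<open>h\<^sub>1, h\<^sub>2, h\<^sub>3 \<in> I\<close> such that \<open>h\<^sub>1\<close> is monic along \<open>v\<close>, \<open>h\<^sub>2\<close> is \<open>v\<close>-invariant and monic along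
  \<open>w\<close>, and \<open>h\<^sub>3 \<noteq> 0\<close> is invariant under both; they form a regular sequence, so division is possible.
\<close>


section \<open>Scalars, variables and monomials as polynomials\<close>

abbreviation cst :: "complex \<Rightarrow> 'k cpoly" where
  "cst \<equiv> Poly_Mapping.single 0"

definition var :: "'k \<Rightarrow> 'k cpoly" where
  "var i = Poly_Mapping.single (Poly_Mapping.single i 1) 1"

abbreviation cmonom :: "('k \<Rightarrow>\<^sub>0 nat) \<Rightarrow> 'k cpoly" where
  "cmonom e \<equiv> Poly_Mapping.single e 1"

lemma cst_mult: "cst (a * b) = cst a * cst b"
  by (simp add: mult_single)

lemma cst_sum: "cst (\<Sum>x\<in>X. f x) = (\<Sum>x\<in>X. cst (f x))"
  by (induction X rule: infinite_finite_induct) (auto simp: single_add)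

lemma cst_power: "cst (c ^ n) = cst c ^ n"
  by (induction n) (auto simp: cst_mult)

lemma cst_prod: "cst (\<Prod>x\<in>X. f x) = (\<Prod>x\<in>X. cst (f x))"
  by (induction X rule: infinite_finite_induct) (auto simp: cst_mult)

lemma cst_eq_0_iff: "cst c = 0 \<longleftrightarrow> c = 0"
  by (metis lookup_single_eq lookup_zero single_zero)

lemma cst_mult_cmonom: "cst c * cmonom e = Poly_Mapping.single e c"
  by (simp add: mult_single)

lemma lookup_cst_mult: "Poly_Mapping.lookup (cst c * p) e = c * Poly_Mapping.lookup p e"
  by (simp flip: mult_map_scale_conv_mult add: map.rep_eq when_def)

lemma cpoly_sum_single:
  "(\<Sum>e\<in>Poly_Mapping.keys p. Poly_Mapping.single e (Poly_Mapping.lookup p e)) = p"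
proof (rule poly_mapping_eqI)
  fix e
  have "(\<Sum>x\<in>Poly_Mapping.keys p. Poly_Mapping.lookup (Poly_Mapping.single x (Poly_Mapping.lookup p x)) e)
      = (\<Sum>x\<in>Poly_Mapping.keys p. if x = e then Poly_Mapping.lookup p e else 0)"
    by (intro sum.cong) (auto simp: lookup_single when_def)
  then show "Poly_Mapping.lookup (\<Sum>x\<in>Poly_Mapping.keys p.
      Poly_Mapping.single x (Poly_Mapping.lookup p x)) e = Poly_Mapping.lookup p e"
    by (auto simp: lookup_sum in_keys_iff)
qed


section \<open>Substitution homomorphisms\<close>

text \<open>The coefficient map \<open>\<kappa>\<close> is a parameter so that evaluation at a
  point, substitution of powers of one variable and translation along a vector are instances of one
  homomorphism.\<close>

definition psubst :: "(complex \<Rightarrow> 'a::comm_ring_1) \<Rightarrow> ('k::finite \<Rightarrow> 'a) \<Rightarrow> 'k cpoly \<Rightarrow> 'a" where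
  "psubst \<kappa> f p = (\<Sum>e\<in>Poly_Mapping.keys p.
     \<kappa> (Poly_Mapping.lookup p e) * (\<Prod>i\<in>UNIV. f i ^ Poly_Mapping.lookup e i))"

locale scalar_hom =
  fixes \<kappa> :: "complex \<Rightarrow> 'a::comm_ring_1"
  assumes one: "\<kappa> 1 = 1"
    and add: "\<kappa> (a + b) = \<kappa> a + \<kappa> b"
    and mult: "\<kappa> (a * b) = \<kappa> a * \<kappa> b"
begin

lemma zero: "\<kappa> 0 = 0"
  using add[of 0 0] by simp

lemma psubst_superset:
  assumes "finite A" "Poly_Mapping.keys p \<subseteq> A"
  shows "psubst \<kappa> f p = (\<Sum>e\<in>A. \<kappa> (Poly_Mapping.lookup p e) * (\<Prod>i\<in>UNIV. f i ^ Poly_Mapping.lookup e i))"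
  unfolding psubst_def using assms
  by (intro sum.mono_neutral_left) (auto simp: in_keys_iff zero)

lemma psubst_0: "psubst \<kappa> f 0 = 0"
  by (simp add: psubst_def)

lemma psubst_single: "psubst \<kappa> f (Poly_Mapping.single e c) = \<kappa> c * (\<Prod>i\<in>UNIV. f i ^ Poly_Mapping.lookup e i)"
  by (subst psubst_superset[of "{e}"]) auto

lemma psubst_add: "psubst \<kappa> f (p + q) = psubst \<kappa> f p + psubst \<kappa> f q"
  using Poly_Mapping.keys_add[of p q]
  by (simp add: psubst_superset[of "Poly_Mapping.keys p \<union> Poly_Mapping.keys q"] lookup_add add
      distrib_right sum.distrib)

lemma psubst_sum: "psubst \<kappa> f (\<Sum>x\<in>X. g x) = (\<Sum>x\<in>X. psubst \<kappa> f (g x))"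
  by (induction X rule: infinite_finite_induct) (auto simp: psubst_0 psubst_add)

lemma psubst_mult: "psubst \<kappa> f (p * q) = psubst \<kappa> f p * psubst \<kappa> f q"
proof -
  have "p * q = (\<Sum>e\<in>Poly_Mapping.keys p. Poly_Mapping.single e (Poly_Mapping.lookup p e)) *
      (\<Sum>e\<in>Poly_Mapping.keys q. Poly_Mapping.single e (Poly_Mapping.lookup q e))"
    by (simp only: cpoly_sum_single)
  also have "\<dots> = (\<Sum>e\<in>Poly_Mapping.keys p. \<Sum>e'\<in>Poly_Mapping.keys q.
      Poly_Mapping.single (e + e') (Poly_Mapping.lookup p e * Poly_Mapping.lookup q e'))"
    by (simp add: sum_product mult_single)
  finally have "psubst \<kappa> f (p * q) = (\<Sum>e\<in>Poly_Mapping.keys p. \<Sum>e'\<in>Poly_Mapping.keys q.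
      (\<kappa> (Poly_Mapping.lookup p e) * (\<Prod>i\<in>UNIV. f i ^ Poly_Mapping.lookup e i)) *
      (\<kappa> (Poly_Mapping.lookup q e') * (\<Prod>i\<in>UNIV. f i ^ Poly_Mapping.lookup e' i)))"
    by (simp add: psubst_sum psubst_single mult lookup_add power_add prod.distrib algebra_simps)
  then show ?thesis by (simp add: psubst_def sum_product)
qed

lemma psubst_cst: "psubst \<kappa> f (cst c) = \<kappa> c"
  by (simp add: psubst_single)

lemma psubst_1: "psubst \<kappa> f 1 = 1"
  using psubst_cst[of f 1] by (simp add: one)

lemma psubst_var: "psubst \<kappa> f (var i) = f i"
proof -
  have "(\<Prod>j\<in>UNIV. f j ^ Poly_Mapping.lookup (Poly_Mapping.single i 1) j) = (\<Prod>j\<in>UNIV. if j = i then f i else 1)"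
    by (intro prod.cong) (auto simp: lookup_single)
  then show ?thesis by (simp add: var_def psubst_single one)
qed

lemma psubst_power: "psubst \<kappa> f (p ^ n) = psubst \<kappa> f p ^ n"
  by (induction n) (auto simp: psubst_1 psubst_mult)

lemma psubst_prod: "psubst \<kappa> f (\<Prod>x\<in>X. g x) = (\<Prod>x\<in>X. psubst \<kappa> f (g x))"
  by (induction X rule: infinite_finite_induct) (auto simp: psubst_1 psubst_mult)

lemma psubst_uminus: "psubst \<kappa> f (- p) = - psubst \<kappa> f p"
  using psubst_add[of f p "- p"] by (simp add: psubst_0 eq_neg_iff_add_eq_0 add.commute)

lemma psubst_diff: "psubst \<kappa> f (p - q) = psubst \<kappa> f p - psubst \<kappa> f q"
  using psubst_add[of f p "- q"] by (simp add: psubst_uminus)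

end

interpretation eval_hom: scalar_hom "\<lambda>c::complex. c"
  by unfold_locales auto

interpretation poly_cst_hom: scalar_hom "\<lambda>c. [:cst c :: 'k::finite cpoly:]"
  by unfold_locales (auto simp: single_add cst_mult one_pCons)

interpretation poly_hom: scalar_hom "\<lambda>c::complex. [:c:]"
  by unfold_locales (auto simp: one_pCons)

lemma poly_eval_psubst: "poly_eval p z = psubst (\<lambda>c. c) (($) z) p"
  by (simp add: poly_eval_def psubst_def)

lemmas poly_eval_simps =
  eval_hom.psubst_0[of "($) z" for z, folded poly_eval_psubst]
  eval_hom.psubst_1[of "($) z" for z, folded poly_eval_psubst]
  eval_hom.psubst_cst[of "($) z" for z, folded poly_eval_psubst]
  eval_hom.psubst_var[of "($) z" for z, folded poly_eval_psubst]
  eval_hom.psubst_add[of "($) z" for z, folded poly_eval_psubst]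
  eval_hom.psubst_diff[of "($) z" for z, folded poly_eval_psubst]
  eval_hom.psubst_mult[of "($) z" for z, folded poly_eval_psubst]
  eval_hom.psubst_power[of "($) z" for z, folded poly_eval_psubst]
  eval_hom.psubst_sum[of "($) z" for z, folded poly_eval_psubst]


section \<open>Polynomial functions\<close>

text \<open>Finitely many hyperplanes do not cover the vectors of natural numbers. If the weight
  found so far is orthogonal to the new \<open>\<delta>\<close>, a large multiple of it is perturbed
  in a coordinate where \<open>\<delta>\<close> is nonzero.\<close>

lemma ex_weight_nonzero:
  fixes D :: "('k::finite \<Rightarrow> int) set"
  assumes "finite D" "\<And>\<delta>. \<delta> \<in> D \<Longrightarrow> \<exists>i. \<delta> i \<noteq> 0"
  shows "\<exists>w :: 'k \<Rightarrow> nat. \<forall>\<delta>\<in>D. (\<Sum>i\<in>UNIV. int (w i) * \<delta> i) \<noteq> 0"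
  using assms
proof (induction D rule: finite_induct)
  case empty
  then show ?case by simp
next
  case (insert \<delta> D)
  then obtain w :: "'k \<Rightarrow> nat" where w: "\<And>\<gamma>. \<gamma> \<in> D \<Longrightarrow> (\<Sum>i\<in>UNIV. int (w i) * \<gamma> i) \<noteq> 0"
    by auto
  obtain k where k: "\<delta> k \<noteq> 0" using insert.prems by blast
  \<comment> \<open>\<open>M\<close> exceeds every \<open>\<bar>\<gamma> k\<bar>\<close>, so the
    perturbation cannot cancel a nonzero multiple of \<open>M\<close>.\<close>
  define M where "M = nat (\<Sum>\<gamma>\<in>D. \<bar>\<gamma> k\<bar>) + 1"
  have M: "\<bar>\<gamma> k\<bar> < int M" if "\<gamma> \<in> D" for \<gamma>
  proof -
    have "\<bar>\<gamma> k\<bar> \<le> (\<Sum>\<gamma>\<in>D. \<bar>\<gamma> k\<bar>)"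
      using that insert.hyps by (intro member_le_sum) auto
    then show ?thesis by (simp add: M_def)
  qed
  define w' where "w' i = M * w i + (if i = k then 1 else 0)" for i
  have w': "(\<Sum>i\<in>UNIV. int (w' i) * \<gamma> i) = int M * (\<Sum>i\<in>UNIV. int (w i) * \<gamma> i) + \<gamma> k" for \<gamma>
  proof -
    have "(\<Sum>i\<in>UNIV. int (w' i) * \<gamma> i) = (\<Sum>i\<in>UNIV. int M * (int (w i) * \<gamma> i) + (if i = k then \<gamma> k else 0))"
      by (intro sum.cong) (auto simp: w'_def algebra_simps)
    then show ?thesis by (simp add: sum.distrib sum_distrib_left)
  qed
  show ?case
  proof (cases "(\<Sum>i\<in>UNIV. int (w i) * \<delta> i) = 0")
    case False
    then show ?thesis using w by blast
  next
    case True
    have "(\<Sum>i\<in>UNIV. int (w' i) * \<gamma> i) \<noteq> 0" if "\<gamma> \<in> D" for \<gamma>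
    proof
      assume "(\<Sum>i\<in>UNIV. int (w' i) * \<gamma> i) = 0"
      then have "\<gamma> k = - int M * (\<Sum>i\<in>UNIV. int (w i) * \<gamma> i)" by (simp add: w')
      then have "\<bar>\<gamma> k\<bar> = int M * \<bar>\<Sum>i\<in>UNIV. int (w i) * \<gamma> i\<bar>" by (simp add: abs_mult)
      moreover have "int M * 1 \<le> int M * \<bar>\<Sum>i\<in>UNIV. int (w i) * \<gamma> i\<bar>"
        using w[OF that] by (intro mult_left_mono) auto
      ultimately show False using M[OF that] by simp
    qed
    moreover have "(\<Sum>i\<in>UNIV. int (w' i) * \<delta> i) \<noteq> 0" using True k by (simp add: w')
    ultimately show ?thesis by blast
  qed
qed

text \<open>Kronecker's trick: \<open>z\<^sub>i \<mapsto> t\<^bsup>w i\<^esup>\<close> keeps the finitely many monomials at hand apart.\<close>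

lemma ex_weight_inj_on:
  fixes F :: "('k::finite \<Rightarrow>\<^sub>0 nat) set"
  assumes "finite F"
  shows "\<exists>w :: 'k \<Rightarrow> nat. inj_on (\<lambda>e. \<Sum>i\<in>UNIV. w i * Poly_Mapping.lookup e i) F"
proof -
  let ?d = "\<lambda>e e' i. int (Poly_Mapping.lookup e i) - int (Poly_Mapping.lookup e' i)"
  let ?D = "(\<lambda>(e, e'). ?d e e') ` {(e, e'). e \<in> F \<and> e' \<in> F \<and> e \<noteq> e'}"
  have "finite {(e, e'). e \<in> F \<and> e' \<in> F \<and> e \<noteq> e'}"
    by (rule finite_subset[of _ "F \<times> F"]) (use assms in auto)
  then have "finite ?D" by (rule finite_imageI)
  moreover have "\<exists>i. \<delta> i \<noteq> 0" if "\<delta> \<in> ?D" for \<delta>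
    using that by (force intro: poly_mapping_eqI)
  ultimately obtain w :: "'k \<Rightarrow> nat" where w: "\<And>\<delta>. \<delta> \<in> ?D \<Longrightarrow> (\<Sum>i\<in>UNIV. int (w i) * \<delta> i) \<noteq> 0"
    using ex_weight_nonzero[of ?D] by blast
  have "inj_on (\<lambda>e. \<Sum>i\<in>UNIV. w i * Poly_Mapping.lookup e i) F"
  proof (rule inj_onI, rule ccontr)
    fix e e' assume e: "e \<in> F" "e' \<in> F" "e \<noteq> e'"
      and eq: "(\<Sum>i\<in>UNIV. w i * Poly_Mapping.lookup e i) = (\<Sum>i\<in>UNIV. w i * Poly_Mapping.lookup e' i)"
    have "(\<Sum>i\<in>UNIV. int (w i) * ?d e e' i) = int (\<Sum>i\<in>UNIV. w i * Poly_Mapping.lookup e i)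
        - int (\<Sum>i\<in>UNIV. w i * Poly_Mapping.lookup e' i)"
      by (simp add: algebra_simps sum_subtractf)
    moreover have "?d e e' \<in> ?D" using e by (intro image_eqI[of _ _ "(e, e')"]) auto
    ultimately show False using w[of "?d e e'"] eq by simp
  qed
  then show ?thesis by blast
qed

text \<open>Distinct monomials of \<open>p\<close> go to distinct powers, so each coefficient of
  \<open>p\<close> survives as a coefficient of the image.\<close>

lemma psubst_monom_nonzero:
  fixes w :: "'k::finite \<Rightarrow> nat"
  assumes inj: "inj_on (\<lambda>e. \<Sum>i\<in>UNIV. w i * Poly_Mapping.lookup e i) F"
    and "Poly_Mapping.keys p \<subseteq> F" "p \<noteq> 0"
  shows "psubst (\<lambda>c. [:c:]) (\<lambda>i. monom 1 (w i)) p \<noteq> 0"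
proof -
  let ?w = "\<lambda>e. \<Sum>i\<in>UNIV. w i * Poly_Mapping.lookup e i"
  have prod: "(\<Prod>i\<in>I. monom 1 (w i) ^ Poly_Mapping.lookup e i) =
      (monom 1 (\<Sum>i\<in>I. w i * Poly_Mapping.lookup e i) :: complex poly)" for e and I :: "'k set"
    by (induction I rule: infinite_finite_induct) (auto simp: monom_power mult_monom)
  obtain e where e: "e \<in> Poly_Mapping.keys p" using \<open>p \<noteq> 0\<close> by (metis keys_eq_empty ex_in_conv)
  have "coeff (psubst (\<lambda>c. [:c:]) (\<lambda>i. monom 1 (w i)) p) (?w e)
      = (\<Sum>x\<in>Poly_Mapping.keys p. if x = e then Poly_Mapping.lookup p e else 0)"
    unfolding psubst_def prod coeff_sum
    using inj e assms(2) by (intro sum.cong) (auto simp: inj_on_def smult_monom)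
  also have "\<dots> \<noteq> 0" using e by (simp add: in_keys_iff)
  finally show ?thesis by auto
qed

text \<open>The weight is chosen for the supports of both factors at once; the substitution then
  carries the product into the integral domain \<open>complex poly\<close> with both factors still
  nonzero.\<close>

lemma cpoly_mult_eq_0_iff: "p * q = 0 \<longleftrightarrow> p = 0 \<or> q = 0" for p q :: "'k::finite cpoly"
proof (rule ccontr)
  assume "\<not> ?thesis"
  then have pq: "p * q = 0" "p \<noteq> 0" "q \<noteq> 0" by auto
  obtain w :: "'k \<Rightarrow> nat" where w: "inj_on (\<lambda>e. \<Sum>i\<in>UNIV. w i * Poly_Mapping.lookup e i)
      (Poly_Mapping.keys p \<union> Poly_Mapping.keys q)"
    using ex_weight_inj_on[of "Poly_Mapping.keys p \<union> Poly_Mapping.keys q"] by auto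
  have "psubst (\<lambda>c. [:c:]) (\<lambda>i. monom 1 (w i)) p * psubst (\<lambda>c. [:c:]) (\<lambda>i. monom 1 (w i)) q = 0"
    using pq(1) by (metis poly_hom.psubst_mult poly_hom.psubst_0)
  then show False
    using psubst_monom_nonzero[OF w, of p] psubst_monom_nonzero[OF w, of q] pq by simp
qed

lemma cpoly_mult_left_cancel: "p \<noteq> 0 \<Longrightarrow> p * q = p * r \<longleftrightarrow> q = r" for p q r :: "'k::finite cpoly"
  using cpoly_mult_eq_0_iff[of p "q - r"] by (auto simp: algebra_simps)

text \<open>On the curve with coordinates \<open>t ^ w i\<close> the polynomial becomes a nonzero
  polynomial in \<open>t\<close>, which has a non-root.\<close>

lemma ex_poly_eval_nonzero:
  fixes p :: "'k::finite cpoly"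
  assumes "p \<noteq> 0"
  shows "\<exists>z. poly_eval p z \<noteq> 0"
proof -
  obtain w :: "'k \<Rightarrow> nat" where w: "inj_on (\<lambda>e. \<Sum>i\<in>UNIV. w i * Poly_Mapping.lookup e i) (Poly_Mapping.keys p)"
    using ex_weight_inj_on[of "Poly_Mapping.keys p"] by auto
  have "poly (psubst (\<lambda>c. [:c:]) (\<lambda>i. monom 1 (w i)) p) t = poly_eval p (\<chi> i. t ^ w i)" for t
    by (simp add: psubst_def poly_eval_def poly_sum poly_prod poly_monom)
  moreover obtain t where "poly (psubst (\<lambda>c. [:c:]) (\<lambda>i. monom 1 (w i)) p) t \<noteq> 0"
    using psubst_monom_nonzero[OF w _ assms] poly_all_0_iff_0 by blast
  ultimately show ?thesis by metis
qed


section \<open>Counting monomials\<close>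

text \<open>Gaussian elimination, one monomial of \<open>M\<close> at a time: some
  \<open>g y\<close> containing the monomial serves as pivot and is removed together with
  it.\<close>

lemma ex_linear_relation:
  fixes g :: "'x \<Rightarrow> 'k cpoly"
  assumes "finite M" "finite X" "card M < card X" "\<And>x. x \<in> X \<Longrightarrow> Poly_Mapping.keys (g x) \<subseteq> M"
  shows "\<exists>c. (\<exists>x\<in>X. c x \<noteq> 0) \<and> (\<Sum>x\<in>X. cst (c x) * g x) = 0"
  using assms
proof (induction M arbitrary: X g rule: finite_induct)
  case empty
  then have "g x = 0" if "x \<in> X" for x using that by simp
  moreover from empty obtain x where "x \<in> X" by fastforce
  ultimately show ?case by (intro exI[of _ "\<lambda>_. 1"]) auto
next
  case (insert e M)
  show ?case
  proof (cases "\<forall>x\<in>X. Poly_Mapping.lookup (g x) e = 0")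
    case True
    then have "Poly_Mapping.keys (g x) \<subseteq> M" if "x \<in> X" for x
      using insert.prems(3)[OF that] that by (auto simp: in_keys_iff)
    with insert.IH[of X g] insert.prems insert.hyps show ?thesis by auto
  next
    case False
    then obtain y where y: "y \<in> X" "Poly_Mapping.lookup (g y) e \<noteq> 0" by blast
    define r where "r x = Poly_Mapping.lookup (g x) e / Poly_Mapping.lookup (g y) e" for x
    define g' where "g' x = g x - cst (r x) * g y" for x
    have keys: "Poly_Mapping.keys (g' x) \<subseteq> M" if x: "x \<in> X - {y}" for x
    proof
      fix e' assume e': "e' \<in> Poly_Mapping.keys (g' x)"
      have "e' \<noteq> e" using e' y by (auto simp: in_keys_iff g'_def r_def lookup_minus lookup_cst_mult)
      moreover have "e' \<in> Poly_Mapping.keys (g x) \<or> e' \<in> Poly_Mapping.keys (g y)"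
        using e' by (auto simp: in_keys_iff g'_def lookup_minus lookup_cst_mult)
      ultimately show "e' \<in> M" using insert.prems(3)[of x] insert.prems(3)[of y] x y by auto
    qed
    have "card M < card (X - {y})" using insert.prems insert.hyps y by simp
    with insert.IH[of "X - {y}" g'] keys insert.prems obtain c
      where c: "\<exists>x\<in>X - {y}. c x \<noteq> 0" "(\<Sum>x\<in>X - {y}. cst (c x) * g' x) = 0" by auto
    \<comment> \<open>The coefficient of the pivot collects the multiples of \<open>g y\<close>
      subtracted in the \<open>g' x\<close>.\<close>
    define c' where "c' x = (if x = y then - (\<Sum>x\<in>X - {y}. c x * r x) else c x)" for x
    have "(\<Sum>x\<in>X. cst (c' x) * g x) = cst (c' y) * g y + (\<Sum>x\<in>X - {y}. cst (c x) * g x)"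
      using insert.prems y by (subst sum.remove[of X y]) (auto simp: c'_def intro!: sum.cong)
    also have "\<dots> = (\<Sum>x\<in>X - {y}. cst (c x) * g' x)"
      by (simp add: c'_def g'_def single_uminus cst_sum sum_distrib_right sum_distrib_left
          right_diff_distrib sum_subtractf cst_mult mult.assoc del: mult_single)
    also have "\<dots> = 0" by (rule c)
    finally have "(\<Sum>x\<in>X. cst (c' x) * g x) = 0" .
    moreover have "\<exists>x\<in>X. c' x \<noteq> 0" using c(1) by (auto simp: c'_def)
    ultimately show ?thesis by blast
  qed
qed

section \<open>Exponent vectors with bounded entries\<close>

lemma bij_betw_lookup:
  "bij_betw Poly_Mapping.lookup {e :: 'k::finite \<Rightarrow>\<^sub>0 nat. \<forall>i. Poly_Mapping.lookup e i \<in> A i} (PiE UNIV A)"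
proof (rule bij_betwI')
  fix f assume "f \<in> PiE UNIV A"
  then show "\<exists>e\<in>{e. \<forall>i. Poly_Mapping.lookup e i \<in> A i}. f = Poly_Mapping.lookup e"
    by (intro bexI[of _ "Abs_poly_mapping f"]) (auto simp: PiE_iff)
qed (auto simp flip: poly_mapping_eq_iff)

lemma card_exponents:
  "card {e :: 'k::finite \<Rightarrow>\<^sub>0 nat. \<forall>i. Poly_Mapping.lookup e i \<in> A i} = (\<Prod>i\<in>UNIV. card (A i))"
  by (subst bij_betw_same_card[OF bij_betw_lookup]) (simp add: card_PiE)

lemma finite_exponents:
  "(\<And>i. finite (A i)) \<Longrightarrow> finite {e :: 'k::finite \<Rightarrow>\<^sub>0 nat. \<forall>i. Poly_Mapping.lookup e i \<in> A i}"
  by (subst bij_betw_finite[OF bij_betw_lookup]) (auto intro: finite_PiE)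

text \<open>Each exponent is bounded separately, not the total degree: the count is then a plain
  power, and the bounds still add under multiplication.\<close>

definition exponent_box :: "nat \<Rightarrow> ('k::finite \<Rightarrow>\<^sub>0 nat) set" where
  "exponent_box d = {e. \<forall>i. Poly_Mapping.lookup e i \<in> {..d}}"

lemma finite_exponent_box: "finite (exponent_box d)"
  unfolding exponent_box_def by (rule finite_exponents) auto

lemma card_exponent_box: "card (exponent_box d :: ('k::finite \<Rightarrow>\<^sub>0 nat) set) = (d + 1) ^ CARD('k)"
  unfolding exponent_box_def card_exponents by simp

lemma ex_keys_subset_box: "\<exists>d. Poly_Mapping.keys p \<subseteq> exponent_box d" for p :: "'k::finite cpoly"
proof -
  have "Poly_Mapping.lookup e i \<le> (\<Sum>e\<in>Poly_Mapping.keys p. \<Sum>i\<in>UNIV. Poly_Mapping.lookup e i)"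
    if "e \<in> Poly_Mapping.keys p" for e and i :: 'k
  proof -
    have "Poly_Mapping.lookup e i \<le> (\<Sum>i\<in>UNIV. Poly_Mapping.lookup e i)"
      by (rule member_le_sum) auto
    also have "\<dots> \<le> (\<Sum>e\<in>Poly_Mapping.keys p. \<Sum>i\<in>UNIV. Poly_Mapping.lookup e i)"
      by (rule member_le_sum[OF that]) auto
    finally show ?thesis .
  qed
  then show ?thesis unfolding exponent_box_def by blast
qed

lemma box_mono: "a \<le> b \<Longrightarrow> exponent_box a \<subseteq> exponent_box b"
  by (auto simp: exponent_box_def intro: order_trans)

lemma keys_mult_box:
  assumes "Poly_Mapping.keys p \<subseteq> exponent_box a" "Poly_Mapping.keys q \<subseteq> exponent_box b"
  shows "Poly_Mapping.keys (p * q) \<subseteq> exponent_box (a + b)"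
  using keys_mult[of p q] assms by (fastforce simp: exponent_box_def lookup_add intro: add_mono)

lemma keys_power_box:
  "Poly_Mapping.keys p \<subseteq> exponent_box a \<Longrightarrow> Poly_Mapping.keys (p ^ n) \<subseteq> exponent_box (n * a)"
proof (induction n)
  case 0
  then show ?case by (simp add: exponent_box_def)
next
  case (Suc n)
  then show ?case using keys_mult_box[of p a "p ^ n" "n * a"] by simp
qed

lemma keys_prod_box:
  "(\<And>x. x \<in> X \<Longrightarrow> Poly_Mapping.keys (f x) \<subseteq> exponent_box (a x)) \<Longrightarrow>
    Poly_Mapping.keys (\<Prod>x\<in>X. f x) \<subseteq> exponent_box (\<Sum>x\<in>X. a x)"
proof (induction X rule: infinite_finite_induct)
  case (insert x X)
  then show ?case using keys_mult_box[of "f x" "a x" "prod f X" "sum a X"] by simp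
qed (auto simp: exponent_box_def)

lemma prod_var_power: "(\<Prod>i\<in>UNIV. var i ^ Poly_Mapping.lookup e i) = cmonom e"
  for e :: "'k::finite \<Rightarrow>\<^sub>0 nat"
proof -
  have power: "var i ^ n = cmonom (Poly_Mapping.single i n)" for i :: 'k and n
    by (induction n) (auto simp: var_def mult_single simp flip: single_add)
  have prod: "(\<Prod>i\<in>I. cmonom (f i)) = cmonom (\<Sum>i\<in>I. f i)" for f :: "'k \<Rightarrow> 'k \<Rightarrow>\<^sub>0 nat" and I
    by (induction I rule: infinite_finite_induct) (auto simp: mult_single)
  have "(\<Sum>i\<in>UNIV. Poly_Mapping.single i (Poly_Mapping.lookup e i)) = e"
    by (rule poly_mapping_eqI) (simp add: lookup_sum lookup_single when_def)
  then show ?thesis by (simp add: power prod)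
qed

lemma cpoly_induct [case_names cst var add mult]:
  fixes p :: "'k::finite cpoly"
  assumes cst: "\<And>c. P (cst c)" and var: "\<And>i. P (var i)"
    and add: "\<And>p q. P p \<Longrightarrow> P q \<Longrightarrow> P (p + q)" and mult: "\<And>p q. P p \<Longrightarrow> P q \<Longrightarrow> P (p * q)"
  shows "P p"
proof -
  have one: "P 1" using cst[of 1] by simp
  have zero: "P 0" using cst[of 0] by simp
  have power: "P (var i ^ n)" for i n by (induction n) (auto simp: one var mult)
  have prod: "P (\<Prod>i\<in>I. var i ^ f i)" for f and I :: "'k set"
    by (induction I rule: infinite_finite_induct) (auto simp: one power mult)
  have "P (Poly_Mapping.single e c)" for e c
    using mult[OF cst prod, of c "Poly_Mapping.lookup e" UNIV]
    by (simp only: prod_var_power cst_mult_cmonom)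
  then have "P (\<Sum>e\<in>K. Poly_Mapping.single e (f e))" for K f
    by (induction K rule: infinite_finite_induct) (auto simp: zero add)
  from this[of "Poly_Mapping.lookup p" "Poly_Mapping.keys p"] show ?thesis
    by (simp add: cpoly_sum_single)
qed


section \<open>Ideals and the Nullstellensatz\<close>

definition is_ideal :: "'a::comm_ring_1 set \<Rightarrow> bool" where
  "is_ideal J \<longleftrightarrow> 0 \<in> J \<and> (\<forall>x\<in>J. \<forall>y\<in>J. x + y \<in> J) \<and> (\<forall>c. \<forall>x\<in>J. c * x \<in> J)"

lemma is_idealI:
  assumes "0 \<in> J" "\<And>x y. x \<in> J \<Longrightarrow> y \<in> J \<Longrightarrow> x + y \<in> J" "\<And>c x. x \<in> J \<Longrightarrow> c * x \<in> J"
  shows "is_ideal J"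
  using assms by (simp add: is_ideal_def)

lemma
  assumes "is_ideal J"
  shows is_ideal_0: "0 \<in> J"
    and is_ideal_add: "x \<in> J \<Longrightarrow> y \<in> J \<Longrightarrow> x + y \<in> J"
    and is_ideal_mult: "x \<in> J \<Longrightarrow> c * x \<in> J"
  using assms by (auto simp: is_ideal_def)

lemma is_ideal_diff: "is_ideal J \<Longrightarrow> x \<in> J \<Longrightarrow> y \<in> J \<Longrightarrow> x - y \<in> J"
  using is_ideal_add[of J x "- 1 * y"] is_ideal_mult[of J y "- 1"] by simp

lemma is_ideal_sum: "is_ideal J \<Longrightarrow> (\<And>x. x \<in> X \<Longrightarrow> f x \<in> J) \<Longrightarrow> sum f X \<in> J"
  by (induction X rule: infinite_finite_induct) (auto simp: is_ideal_0 is_ideal_add)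

definition prime_ideal :: "'a::comm_ring_1 set \<Rightarrow> bool" where
  "prime_ideal P \<longleftrightarrow> is_ideal P \<and> 1 \<notin> P \<and> (\<forall>a b. a * b \<in> P \<longrightarrow> a \<in> P \<or> b \<in> P)"

text \<open>By Zorn's lemma there is an ideal maximal among those disjoint from the multiplicatively
  closed set \<open>T\<close>, and such an ideal is prime. The last clause keeps the maximality, for
  use in the Nullstellensatz.\<close>

lemma ex_prime_ideal_avoiding:
  fixes J T :: "'a::comm_ring_1 set"
  assumes J: "is_ideal J" and T: "1 \<in> T" "\<And>s t. s \<in> T \<Longrightarrow> t \<in> T \<Longrightarrow> s * t \<in> T" and JT: "J \<inter> T = {}"
  shows "\<exists>P. prime_ideal P \<and> J \<subseteq> P \<and> P \<inter> T = {} \<and> (\<forall>x. x \<notin> P \<longrightarrow> (\<exists>m\<in>P. \<exists>r. m + r * x \<in> T))"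
proof -
  let ?A = "{M. is_ideal M \<and> J \<subseteq> M \<and> M \<inter> T = {}}"
  have "\<exists>M\<in>?A. \<forall>X\<in>?A. M \<subseteq> X \<longrightarrow> X = M"
  proof (rule subset_Zorn_nonempty)
    show "?A \<noteq> {}" using J JT by blast
    fix C assume C: "C \<noteq> {}" "subset.chain ?A C"
    have sub: "is_ideal X" "J \<subseteq> X" "X \<inter> T = {}" if "X \<in> C" for X
      using C(2) that by (auto simp: subset.chain_def)
    have "is_ideal (\<Union>C)"
    proof (rule is_idealI)
      show "0 \<in> \<Union>C" using C(1) sub(1) is_ideal_0 by blast
      fix x y assume "x \<in> \<Union>C" "y \<in> \<Union>C"
      then obtain X Y where XY: "X \<in> C" "Y \<in> C" "x \<in> X" "y \<in> Y" by blast
      then have "X \<subseteq> Y \<or> Y \<subseteq> X" using C(2) unfolding subset.chain_def by blast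
      then show "x + y \<in> \<Union>C"
        using XY sub(1) by (metis UnionI is_ideal_add subsetD)
    next
      fix c x assume "x \<in> \<Union>C"
      then show "c * x \<in> \<Union>C" using sub(1) is_ideal_mult by blast
    qed
    then show "\<Union>C \<in> ?A" using C(1) sub by blast
  qed
  then obtain M where M: "is_ideal M" "J \<subseteq> M" "M \<inter> T = {}"
    and max: "\<And>X. is_ideal X \<Longrightarrow> J \<subseteq> X \<Longrightarrow> X \<inter> T = {} \<Longrightarrow> M \<subseteq> X \<Longrightarrow> X = M" by auto
  have meets: "\<exists>m\<in>M. \<exists>r. m + r * x \<in> T" if "x \<notin> M" for x
  proof (rule ccontr)
    assume none: "\<not> ?thesis"
    let ?X = "{m + r * x | m r. m \<in> M}"
    have "is_ideal ?X"
    proof (rule is_idealI)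
      show "0 \<in> ?X" using is_ideal_0[OF M(1)] by (auto intro!: exI[of _ 0])
    next
      fix a b assume "a \<in> ?X" "b \<in> ?X"
      then obtain m r m' r' where "a = m + r * x" "b = m' + r' * x" "m \<in> M" "m' \<in> M" by blast
      moreover have "(m + r * x) + (m' + r' * x) = (m + m') + (r + r') * x"
        by (simp add: algebra_simps)
      ultimately show "a + b \<in> ?X" using is_ideal_add[OF M(1)] by blast
    next
      fix c a assume "a \<in> ?X"
      then obtain m r where "a = m + r * x" "m \<in> M" by blast
      moreover have "c * (m + r * x) = c * m + (c * r) * x" by (simp add: algebra_simps)
      ultimately show "c * a \<in> ?X" using is_ideal_mult[OF M(1)] by blast
    qed
    moreover have sub: "M \<subseteq> ?X"
    proof
      fix m assume "m \<in> M"
      then show "m \<in> ?X" by (intro CollectI exI[of _ m] exI[of _ 0]) simp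
    qed
    ultimately have "?X = M" using max[of ?X] M none by blast
    moreover have "x \<in> ?X"
      using is_ideal_0[OF M(1)] by (intro CollectI exI[of _ 0] exI[of _ 1]) simp
    ultimately show False using that by simp
  qed
  have "prime_ideal M"
    unfolding prime_ideal_def
  proof (intro conjI allI impI)
    show "is_ideal M" "1 \<notin> M" using M T by auto
    fix a b assume ab: "a * b \<in> M"
    show "a \<in> M \<or> b \<in> M"
    proof (rule ccontr)
      assume "\<not> ?thesis"
      then obtain m r m' r' where *: "m \<in> M" "m + r * a \<in> T" "m' \<in> M" "m' + r' * b \<in> T"
        using meets by blast
      \<comment> \<open>A product of two elements of \<open>T\<close> that falls into
        \<open>M\<close> because \<open>a * b\<close> does.\<close>
      have "(m + r * a) * (m' + r' * b) = (m' + r' * b) * m + (r * a) * m' + (r * r') * (a * b)"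
        by (simp add: algebra_simps)
      also have "\<dots> \<in> M"
        using * ab by (simp add: is_ideal_add[OF M(1)] is_ideal_mult[OF M(1)])
      finally show False using T(2)[OF *(2,4)] M(3) by blast
    qed
  qed
  with M meets show ?thesis by blast
qed

section \<open>The Nullstellensatz by counting over the uncountable field of complex numbers\<close>

lemma map_poly_cst_mult: "map_poly cst (p * q) = map_poly cst p * (map_poly cst q :: 'k cpoly poly)"
proof (rule poly_eqI)
  fix n
  show "coeff (map_poly cst (p * q)) n = coeff (map_poly cst p * (map_poly cst q :: 'k cpoly poly)) n"
    by (simp add: coeff_map_poly coeff_mult cst_mult cst_sum)
qed

lemma map_poly_cst_add: "map_poly cst (p + q) = map_poly cst p + (map_poly cst q :: 'k cpoly poly)"
  by (rule poly_eqI) (simp add: coeff_map_poly single_add)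

lemma map_poly_cst_sum: "map_poly cst (\<Sum>x\<in>X. f x) = (\<Sum>x\<in>X. map_poly cst (f x) :: 'k cpoly poly)"
  by (induction X rule: infinite_finite_induct) (auto simp: map_poly_cst_add)

lemma map_poly_cst_prod: "map_poly cst (\<Prod>x\<in>X. f x) = (\<Prod>x\<in>X. map_poly cst (f x) :: 'k cpoly poly)"
  by (induction X rule: infinite_finite_induct) (auto simp: map_poly_cst_mult map_poly_1')

text \<open>Over the complex numbers \<open>g\<close> splits into linear factors, and primality
  picks one whose value at \<open>x\<close> lies in \<open>M\<close>. A nonzero constant, being a
  unit, cannot lie in \<open>M\<close>.\<close>

lemma prime_ideal_root:
  fixes M :: "'k cpoly set"
  assumes M: "prime_ideal M" and "g \<noteq> 0" "poly (map_poly cst g) x \<in> M"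
  shows "\<exists>c. x - cst c \<in> M"
  using assms(2,3)
proof (induction "degree g" arbitrary: g rule: less_induct)
  case less
  show ?case
  proof (cases "degree g = 0")
    case True
    then obtain a where g: "g = [:a:]" by (rule degree_eq_zeroE)
    with less.prems have a: "a \<noteq> 0" "cst a \<in> M" by (auto simp: map_poly_pCons)
    have "cst (inverse a) * cst a \<in> M"
      using a(2) M is_ideal_mult unfolding prime_ideal_def by blast
    then have "(1 :: 'k cpoly) \<in> M" using a(1) by (simp flip: cst_mult)
    then show ?thesis using M by (simp add: prime_ideal_def)
  next
    case False
    then obtain r where "poly g r = 0"
      using fundamental_theorem_of_algebra[of g] constant_degree[of g] by auto
    then obtain g' where g': "g = [:- r, 1:] * g'" by (auto simp: poly_eq_0_iff_dvd elim: dvdE)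
    have "g' \<noteq> 0" using g' less.prems by auto
    then have deg: "degree g' < degree g" unfolding g' by (subst degree_mult_eq) auto
    have "poly (map_poly cst [:- r, 1:]) x = x - cst r"
      by (simp add: map_poly_pCons single_uminus)
    then have "(x - cst r) * poly (map_poly cst g') x \<in> M"
      using less.prems(2) unfolding g' map_poly_cst_mult poly_mult by simp
    then show ?thesis
      using M less.hyps[OF deg \<open>g' \<noteq> 0\<close>] unfolding prime_ideal_def by blast
  qed
qed

text \<open>
  In an ideal \<open>M\<close> maximal among those containing no power of \<open>q\<close>, every coordinate is congruent
  to a scalar: otherwise \<open>q ^ k\<close> would be divisible by \<open>x - c\<close> modulo \<open>M\<close> for uncountably
  many \<open>c\<close>, infinitely many of the quotients would lie in one finite-dimensional space, and a linear
  relation between them makes \<open>x\<close> algebraic modulo \<open>M\<close>.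
\<close>

lemma ex_scalar_congruent:
  fixes M :: "'k::finite cpoly set" and x :: "'k cpoly"
  assumes M: "prime_ideal M" and q: "\<And>k. q ^ k \<notin> M"
    and max: "\<And>y. y \<notin> M \<Longrightarrow> \<exists>m\<in>M. \<exists>r k. m + r * y = q ^ k"
  shows "\<exists>c. x - cst c \<in> M"
proof (rule ccontr)
  assume none: "\<not> ?thesis"
  have I: "is_ideal M" using M by (simp add: prime_ideal_def)
  have "\<forall>c. \<exists>s k d. q ^ k - s * (x - cst c) \<in> M \<and> Poly_Mapping.keys s \<subseteq> exponent_box d"
  proof
    fix c
    obtain m s k where "m \<in> M" "m + s * (x - cst c) = q ^ k" using max none by blast
    moreover have "m = q ^ k - s * (x - cst c)" using calculation by (simp add: algebra_simps)
    ultimately show "\<exists>s k d. q ^ k - s * (x - cst c) \<in> M \<and> Poly_Mapping.keys s \<subseteq> exponent_box d"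
      using ex_keys_subset_box[of s] by metis
  qed
  then obtain s k d where s: "\<And>c. q ^ k c - s c * (x - cst c) \<in> M"
    "\<And>c. Poly_Mapping.keys (s c) \<subseteq> exponent_box (d c)" by metis
  \<comment> \<open>There are uncountably many scalars \<open>c\<close> but only countably many
    pairs of a power \<open>k c\<close> and a box size \<open>d c\<close>.\<close>
  have "\<exists>K D. infinite {c. k c = K \<and> d c = D}"
  proof (rule ccontr)
    assume "\<not> ?thesis"
    then have "countable (\<Union>K. \<Union>D. {c :: complex. k c = K \<and> d c = D})"
      by (intro countable_UN) (auto intro: countable_finite)
    moreover have "(\<Union>K. \<Union>D. {c. k c = K \<and> d c = D}) = UNIV" by auto
    ultimately show False using uncountable_UNIV_complex by simp
  qed
  then obtain K D where "infinite {c. k c = K \<and> d c = D}" by blast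
  then obtain X where X: "X \<subseteq> {c. k c = K \<and> d c = D}" "finite X"
    "card X = card (exponent_box D :: ('k \<Rightarrow>\<^sub>0 nat) set) + 1"
    using infinite_arbitrarily_large by metis
  have sX: "q ^ K - s c * (x - cst c) \<in> M" "Poly_Mapping.keys (s c) \<subseteq> exponent_box D" if "c \<in> X" for c
    using s[of c] X(1) that by auto
  obtain l where l: "\<exists>c\<in>X. l c \<noteq> 0" "(\<Sum>c\<in>X. cst (l c) * s c) = 0"
    using ex_linear_relation[OF finite_exponent_box X(2), of D s] X(3) sX(2) by auto
  \<comment> \<open>Modulo \<open>M\<close>, \<open>s c\<close> plays the part of
    \<open>q ^ K / (x - c)\<close>; clearing denominators in the linear relation gives
    \<open>g\<close>. At a node \<open>c\<close> only one summand survives, whence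
    \<open>g \<noteq> 0\<close>.\<close>
  define g where "g = (\<Sum>c\<in>X. [:l c:] * (\<Prod>c'\<in>X - {c}. [:- c', 1:]))"
  have "g \<noteq> 0"
  proof -
    obtain c where c: "c \<in> X" "l c \<noteq> 0" using l by blast
    have "poly g c = (\<Sum>b\<in>X. if b = c then l c * (\<Prod>c'\<in>X - {c}. c - c') else 0)"
      unfolding g_def poly_sum using c X(2)
      by (intro sum.cong) (auto simp: poly_prod prod_zero_iff)
    also have "\<dots> \<noteq> 0" using c X(2) by (auto simp: prod_zero_iff)
    finally show ?thesis by auto
  qed
  have eq: "poly (map_poly cst g) x = (\<Sum>c\<in>X. cst (l c) * (\<Prod>c'\<in>X - {c}. x - cst c'))"
    by (simp add: g_def map_poly_cst_sum map_poly_cst_mult map_poly_cst_prod poly_sum poly_prod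
        map_poly_pCons single_uminus del: mult_pCons_left)
  have id: "a * (b * p) = b * p * (a - t * y) + b * t * (y * p)" for a b p t y :: "'k cpoly"
    by (simp add: algebra_simps)
  \<comment> \<open>The first sum lies in \<open>M\<close> term by term, and the second contains the
    linear relation as a factor.\<close>
  have "q ^ K * poly (map_poly cst g) x
      = (\<Sum>c\<in>X. cst (l c) * (\<Prod>c'\<in>X - {c}. x - cst c') * (q ^ K - s c * (x - cst c)))
      + (\<Sum>c\<in>X. cst (l c) * s c * ((x - cst c) * (\<Prod>c'\<in>X - {c}. x - cst c')))"
    unfolding eq sum_distrib_left sum.distrib[symmetric] by (intro sum.cong refl id)
  also have "(\<Sum>c\<in>X. cst (l c) * s c * ((x - cst c) * (\<Prod>c'\<in>X - {c}. x - cst c')))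
      = (\<Sum>c\<in>X. cst (l c) * s c) * (\<Prod>c\<in>X. x - cst c)"
    unfolding sum_distrib_right
    by (intro sum.cong refl arg_cong2[where f = "(*)"] prod.remove[symmetric] X(2))
  also have "\<dots> = 0" by (simp add: l)
  also have "(\<Sum>c\<in>X. cst (l c) * (\<Prod>c'\<in>X - {c}. x - cst c') * (q ^ K - s c * (x - cst c))) + 0 \<in> M"
    using sX(1) by (auto intro!: is_ideal_sum[OF I] is_ideal_mult[OF I])
  finally have "poly (map_poly cst g) x \<in> M" using M q[of K] by (auto simp: prime_ideal_def)
  then show False using prime_ideal_root[OF M \<open>g \<noteq> 0\<close>] none by blast
qed

text \<open>The strong form is reached directly, by avoiding the powers of \<open>q\<close> instead
  of adjoining an inverse of \<open>q\<close>. In a maximal such ideal \<open>M\<close> the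
  variables are congruent to scalars, and these are the coordinates of the point.\<close>

lemma nullstellensatz:
  fixes J :: "'k::finite cpoly set"
  assumes "is_ideal J" and "\<And>k. q ^ k \<notin> J"
  shows "\<exists>z. (\<forall>p\<in>J. poly_eval p z = 0) \<and> poly_eval q z \<noteq> 0"
proof -
  obtain M where M: "prime_ideal M" "J \<subseteq> M" "M \<inter> {q ^ k | k. True} = {}"
    and max: "\<And>y. y \<notin> M \<Longrightarrow> \<exists>m\<in>M. \<exists>r. m + r * y \<in> {q ^ k | k. True}"
  proof -
    have "1 \<in> {q ^ k | k. True}" by (auto intro: exI[of _ 0])
    moreover have "s * t \<in> {q ^ k | k. True}" if "s \<in> {q ^ k | k. True}" "t \<in> {q ^ k | k. True}" for s t
      using that by clarify (metis power_add)
    moreover have "J \<inter> {q ^ k | k. True} = {}" using assms(2) by auto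
    ultimately have "\<exists>M. prime_ideal M \<and> J \<subseteq> M \<and> M \<inter> {q ^ k | k. True} = {} \<and>
        (\<forall>y. y \<notin> M \<longrightarrow> (\<exists>m\<in>M. \<exists>r. m + r * y \<in> {q ^ k | k. True}))"
      by (intro ex_prime_ideal_avoiding[OF assms(1)])
    then show ?thesis using that by blast
  qed
  have I: "is_ideal M" and 1: "1 \<notin> M" using M by (auto simp: prime_ideal_def)
  have qM: "q ^ k \<notin> M" for k using M(3) by blast
  have "\<exists>c. var i - cst c \<in> M" for i
    using max by (intro ex_scalar_congruent[OF M(1) qM]) blast
  then obtain c where c: "\<And>i. var i - cst (c i) \<in> M" by metis
  define z where "z = (\<chi> i. c i)"
  \<comment> \<open>Reduction modulo \<open>M\<close> and evaluation at \<open>z\<close> agree on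
    scalars and variables, hence everywhere.\<close>
  have cong: "p - cst (poly_eval p z) \<in> M" for p
  proof (induction p rule: cpoly_induct)
    case (add p q)
    then have "(p - cst (poly_eval p z)) + (q - cst (poly_eval q z)) \<in> M"
      by (intro is_ideal_add[OF I])
    then show ?case by (simp add: poly_eval_simps single_add algebra_simps)
  next
    case (mult p q)
    then have "q * (p - cst (poly_eval p z)) + cst (poly_eval p z) * (q - cst (poly_eval q z)) \<in> M"
      by (intro is_ideal_add[OF I] is_ideal_mult[OF I])
    then show ?case by (simp add: poly_eval_simps cst_mult algebra_simps)
  qed (use c is_ideal_0[OF I] in \<open>auto simp: poly_eval_simps z_def\<close>)
  have unit: "a = 0" if "cst a \<in> M" for a
  proof (rule ccontr)
    assume "a \<noteq> 0"
    then have "1 = cst (inverse a) * (cst a :: 'k cpoly)" by (simp flip: cst_mult)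
    then show False using is_ideal_mult[OF I that] 1 by metis
  qed
  have "poly_eval p z = 0" if "p \<in> J" for p
    using is_ideal_diff[OF I _ cong[of p], of p] that M(2) by (auto intro: unit)
  moreover have "poly_eval q z \<noteq> 0" using cong[of q] qM[of 1] by auto
  ultimately show ?thesis by blast
qed


section \<open>Irreducible closed sets and prime ideals\<close>

definition zeros :: "'k::finite cpoly set \<Rightarrow> (complex ^ 'k) set" where
  "zeros F = {z. \<forall>p\<in>F. poly_eval p z = 0}"

definition vanishing :: "(complex ^ 'k::finite) set \<Rightarrow> 'k cpoly set" where
  "vanishing Y = {p. \<forall>z\<in>Y. poly_eval p z = 0}"

lemma zariski_closed_zeros: "zariski_closed (zeros F)"
  unfolding zariski_closed_def zeros_def by blast

lemma zeros_vanishing: "zariski_closed Y \<Longrightarrow> zeros (vanishing Y) = Y"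
  unfolding zariski_closed_def zeros_def vanishing_def by auto

lemma is_ideal_vanishing: "is_ideal (vanishing Y)"
  by (rule is_idealI) (auto simp: vanishing_def poly_eval_simps)

text \<open>No power of a polynomial outside the prime \<open>P\<close> lies in \<open>P\<close>, so
  \<open>nullstellensatz\<close> supplies a zero of \<open>P\<close> where it does not
  vanish.\<close>

lemma vanishing_zeros_prime:
  assumes "prime_ideal P"
  shows "vanishing (zeros P) = P"
proof
  show "P \<subseteq> vanishing (zeros P)" by (auto simp: vanishing_def zeros_def)
  show "vanishing (zeros P) \<subseteq> P"
  proof (rule subsetI, rule ccontr)
    fix q assume q: "q \<in> vanishing (zeros P)" "q \<notin> P"
    have "q ^ k \<notin> P" for k
      using assms q(2) by (induction k) (auto simp: prime_ideal_def)
    then obtain z where "\<forall>p\<in>P. poly_eval p z = 0" "poly_eval q z \<noteq> 0"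
      using nullstellensatz assms by (metis prime_ideal_def)
    then show False using q(1) by (auto simp: vanishing_def zeros_def)
  qed
qed

text \<open>If proper closed subsets \<open>A\<close> and \<open>B\<close> covered the zero set, a
  polynomial vanishing on \<open>A\<close> and one vanishing on \<open>B\<close>, neither of them
  vanishing on the whole, would have their product in \<open>P\<close>.\<close>

lemma irreducible_closed_zeros:
  assumes P: "prime_ideal P"
  shows "irreducible_closed (zeros P)"
  unfolding irreducible_closed_def
proof (intro conjI allI impI zariski_closed_zeros)
  have "1 \<notin> vanishing (zeros P)" using P by (simp add: vanishing_zeros_prime prime_ideal_def)
  then show "zeros P \<noteq> {}" by (auto simp: vanishing_def)
next
  fix A B assume AB: "zariski_closed A \<and> zariski_closed B \<and> zeros P = A \<union> B"
  show "zeros P = A \<or> zeros P = B"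
  proof (rule ccontr)
    assume "\<not> ?thesis"
    with AB obtain a b where ab: "a \<in> zeros P" "a \<notin> A" "b \<in> zeros P" "b \<notin> B" by blast
    obtain f where f: "f \<in> vanishing A" "poly_eval f a \<noteq> 0"
      using AB ab(2) by (auto simp: zariski_closed_def vanishing_def)
    obtain g where g: "g \<in> vanishing B" "poly_eval g b \<noteq> 0"
      using AB ab(4) by (auto simp: zariski_closed_def vanishing_def)
    have "f * g \<in> vanishing (zeros P)"
      using AB f g by (auto simp: vanishing_def poly_eval_simps)
    then have "f \<in> vanishing (zeros P) \<or> g \<in> vanishing (zeros P)"
      using P by (simp add: vanishing_zeros_prime prime_ideal_def)
    then show False using ab f g by (auto simp: vanishing_def)
  qed
qed

lemma prime_ideal_vanishing:
  assumes "irreducible_closed Y"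
  shows "prime_ideal (vanishing Y)"
  unfolding prime_ideal_def
proof (intro conjI allI impI is_ideal_vanishing)
  show "1 \<notin> vanishing Y"
    using assms by (auto simp: vanishing_def irreducible_closed_def poly_eval_simps)
  fix f g assume "f * g \<in> vanishing Y"
  then have "Y = zeros (insert f (vanishing Y)) \<union> zeros (insert g (vanishing Y))"
    using zeros_vanishing[of Y] assms
    by (auto simp: irreducible_closed_def zeros_def vanishing_def poly_eval_simps)
  then have "Y = zeros (insert f (vanishing Y)) \<or> Y = zeros (insert g (vanishing Y))"
    using assms zariski_closed_zeros unfolding irreducible_closed_def by metis
  then show "f \<in> vanishing Y \<or> g \<in> vanishing Y"
    by (auto simp: zeros_def vanishing_def)
qed


section \<open>Translations and invariant polynomials\<close>

text \<open>\<open>shift v p\<close> is \<open>p (z + T v)\<close>, as a polynomial in \<open>T\<close>.\<close>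

definition shift :: "complex ^ 'k \<Rightarrow> 'k::finite cpoly \<Rightarrow> 'k cpoly poly" where
  "shift v = psubst (\<lambda>c. [:cst c:]) (\<lambda>i. [:var i, cst (v $ i):])"

lemmas shift_simps =
  poly_cst_hom.psubst_0[of "\<lambda>i. [:var i, cst (v $ i):]" for v, folded shift_def]
  poly_cst_hom.psubst_1[of "\<lambda>i. [:var i, cst (v $ i):]" for v, folded shift_def]
  poly_cst_hom.psubst_cst[of "\<lambda>i. [:var i, cst (v $ i):]" for v, folded shift_def]
  poly_cst_hom.psubst_var[of "\<lambda>i. [:var i, cst (v $ i):]" for v, folded shift_def]
  poly_cst_hom.psubst_add[of "\<lambda>i. [:var i, cst (v $ i):]" for v, folded shift_def]
  poly_cst_hom.psubst_diff[of "\<lambda>i. [:var i, cst (v $ i):]" for v, folded shift_def]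
  poly_cst_hom.psubst_mult[of "\<lambda>i. [:var i, cst (v $ i):]" for v, folded shift_def]

text \<open>This coefficient is the value at \<open>T = 0\<close>.\<close>

lemma coeff_shift_0: "coeff (shift v p) 0 = p"
  by (induction p rule: cpoly_induct) (auto simp: shift_simps coeff_mult_0)

definition invariants :: "complex ^ 'k \<Rightarrow> 'k::finite cpoly set" where
  "invariants v = {p. shift v p = [:p:]}"

lemma invariants_0: "0 \<in> invariants v" and invariants_1: "1 \<in> invariants v"
  and invariants_cst: "cst c \<in> invariants v"
  by (auto simp: invariants_def shift_simps one_pCons)

lemma invariants_add: "p \<in> invariants v \<Longrightarrow> q \<in> invariants v \<Longrightarrow> p + q \<in> invariants v"
  by (auto simp: invariants_def shift_simps)

lemma invariants_mult: "p \<in> invariants v \<Longrightarrow> q \<in> invariants v \<Longrightarrow> p * q \<in> invariants v"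
  by (auto simp: invariants_def shift_simps)

lemma invariants_sum: "(\<And>x. x \<in> X \<Longrightarrow> f x \<in> invariants v) \<Longrightarrow> sum f X \<in> invariants v"
  by (induction X rule: infinite_finite_induct) (auto simp: invariants_0 invariants_add)

lemma invariants_power: "p \<in> invariants v \<Longrightarrow> p ^ n \<in> invariants v"
  by (induction n) (auto simp: invariants_1 invariants_mult)

lemma invariants_prod: "(\<And>x. x \<in> X \<Longrightarrow> f x \<in> invariants v) \<Longrightarrow> prod f X \<in> invariants v"
  by (induction X rule: infinite_finite_induct) (auto simp: invariants_1 invariants_mult)

section \<open>Leading coefficients along a direction\<close>

definition monic_along :: "complex ^ 'k \<Rightarrow> 'k::finite cpoly \<Rightarrow> bool" where
  "monic_along v h \<longleftrightarrow>
    (\<exists>n c. c \<noteq> 0 \<and> coeff (shift v h) n = cst c \<and> (\<forall>m>n. coeff (shift v h) m = 0))"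

text \<open>The bounds \<open>m\<close> and \<open>n\<close> need not be the degrees, so zero
  polynomials and zero divisors cause no exception.\<close>

lemma coeff_mult_top:
  fixes p q :: "'a::comm_ring_1 poly"
  assumes "\<And>k. k > m \<Longrightarrow> coeff p k = 0" "\<And>k. k > n \<Longrightarrow> coeff q k = 0"
  shows "coeff (p * q) (m + n) = coeff p m * coeff q n"
    and "k > m + n \<Longrightarrow> coeff (p * q) k = 0"
proof -
  have "coeff p i * coeff q (m + n - i) = (if i = m then coeff p m * coeff q n else 0)" for i
    using assms(1)[of i] assms(2)[of "m + n - i"] by (cases i m rule: linorder_cases) auto
  then show "coeff (p * q) (m + n) = coeff p m * coeff q n" by (simp add: coeff_mult)
  have "coeff p i * coeff q (k - i) = 0" if "k > m + n" for i
    using that assms(1)[of i] assms(2)[of "k - i"] by (cases "i > m") auto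
  then show "k > m + n \<Longrightarrow> coeff (p * q) k = 0" by (simp add: coeff_mult)
qed

lemma coeff_linear_power_top:
  fixes a b :: "'a::comm_ring_1"
  shows "coeff ([:a, b:] ^ n) n = b ^ n" and "k > n \<Longrightarrow> coeff ([:a, b:] ^ n) k = 0"
proof -
  have lin: "coeff [:a, b:] k = 0" if "k > 1" for k
    using that by (simp add: coeff_pCons split: nat.split)
  have "coeff ([:a, b:] ^ n) n = b ^ n \<and> (\<forall>k>n. coeff ([:a, b:] ^ n) k = 0)"
  proof (induction n)
    case 0
    then show ?case by (simp add: coeff_1)
  next
    case (Suc n)
    then show ?case
      using coeff_mult_top[of 1 "[:a, b:]" n "[:a, b:] ^ n"] lin by auto
  qed
  then show "coeff ([:a, b:] ^ n) n = b ^ n" and "k > n \<Longrightarrow> coeff ([:a, b:] ^ n) k = 0" by auto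
qed

lemma coeff_prod_top:
  fixes p :: "'x \<Rightarrow> 'a::comm_ring_1 poly"
  assumes "finite X" "\<And>x k. x \<in> X \<Longrightarrow> k > n x \<Longrightarrow> coeff (p x) k = 0"
  shows "coeff (\<Prod>x\<in>X. p x) (\<Sum>x\<in>X. n x) = (\<Prod>x\<in>X. coeff (p x) (n x)) \<and>
    (\<forall>k>\<Sum>x\<in>X. n x. coeff (\<Prod>x\<in>X. p x) k = 0)"
  using assms
proof (induction X rule: finite_induct)
  case empty
  then show ?case by (simp add: coeff_1)
next
  case (insert x X)
  then show ?case using coeff_mult_top[of "n x" "p x" "sum n X" "prod p X"] by auto
qed

text \<open>With \<open>n\<close> the total degree of \<open>f\<close>, the coefficient of
  \<open>T ^ n\<close> in \<open>f (z + T v)\<close> is the value at \<open>v\<close> of the top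
  homogeneous part \<open>top\<close>. As \<open>top \<noteq> 0\<close>, some \<open>v\<close> gives
  a nonzero value.\<close>

lemma ex_monic_along:
  fixes f :: "'k::finite cpoly"
  assumes "f \<noteq> 0"
  shows "\<exists>v. monic_along v f"
proof -
  let ?K = "Poly_Mapping.keys f" and ?c = "Poly_Mapping.lookup f"
  define deg :: "('k \<Rightarrow>\<^sub>0 nat) \<Rightarrow> nat" where "deg e = (\<Sum>i\<in>UNIV. Poly_Mapping.lookup e i)" for e
  define n where "n = Max (deg ` ?K)"
  have "n \<in> deg ` ?K" unfolding n_def by (rule Max_in) (use assms in auto)
  then obtain e0 where e0: "e0 \<in> ?K" "deg e0 = n" by blast
  have le: "deg e \<le> n" if "e \<in> ?K" for e using that by (simp add: n_def)
  define top where "top = (\<Sum>e\<in>?K. Poly_Mapping.single e (if deg e = n then ?c e else 0))"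
  have "Poly_Mapping.lookup top e0 = (\<Sum>e\<in>?K. if e = e0 then ?c e0 else 0)"
    unfolding top_def lookup_sum using e0
    by (intro sum.cong) (auto simp: lookup_single when_def)
  then have "top \<noteq> 0" using e0 by (auto simp: in_keys_iff)
  then obtain v where v: "poly_eval top v \<noteq> 0" using ex_poly_eval_nonzero by blast
  define Q where "Q e = (\<Prod>i\<in>UNIV. [:var i, cst (v $ i):] ^ Poly_Mapping.lookup e i)" for e
  have Q: "coeff (Q e) (deg e) = cst (\<Prod>i\<in>UNIV. v $ i ^ Poly_Mapping.lookup e i)"
    "\<And>k. k > deg e \<Longrightarrow> coeff (Q e) k = 0" for e
    unfolding Q_def deg_def
    using coeff_prod_top[of UNIV "Poly_Mapping.lookup e" "\<lambda>i. [:var i, cst (v $ i):] ^ Poly_Mapping.lookup e i"]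
    by (auto simp: coeff_linear_power_top cst_prod cst_power)
  have shift: "coeff (shift v f) m = (\<Sum>e\<in>?K. cst (?c e) * coeff (Q e) m)" for m
    by (simp add: shift_def psubst_def coeff_sum Q_def)
  have "coeff (shift v f) n = (\<Sum>e\<in>?K. cst ((if deg e = n then ?c e else 0) *
      (\<Prod>i\<in>UNIV. v $ i ^ Poly_Mapping.lookup e i)))"
    unfolding shift
  proof (rule sum.cong[OF refl])
    fix e assume e: "e \<in> ?K"
    show "cst (?c e) * coeff (Q e) n = cst ((if deg e = n then ?c e else 0) *
        (\<Prod>i\<in>UNIV. v $ i ^ Poly_Mapping.lookup e i))"
      using le[OF e] Q(1)[of e] Q(2)[of e n] by (cases "deg e = n") (auto simp: cst_mult)
  qed
  also have "\<dots> = cst (poly_eval top v)"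
    by (simp add: top_def poly_eval_psubst eval_hom.psubst_sum eval_hom.psubst_single cst_sum)
  finally have "coeff (shift v f) n = cst (poly_eval top v)" .
  moreover have "coeff (shift v f) m = 0" if "m > n" for m
    unfolding shift using le that Q(2) by (intro sum.neutral) fastforce
  ultimately show ?thesis using v unfolding monic_along_def by blast
qed

text \<open>A polynomial with a unit as leading coefficient is not a zero divisor modulo
  \<open>J\<close>; the coefficients of \<open>F\<close> are shown to lie in \<open>J\<close> from
  the highest downwards.\<close>

lemma coeff_in_ideal_if_mult:
  fixes H F :: "'a::comm_ring_1 poly"
  assumes J: "is_ideal J" and H: "\<And>m. m > n \<Longrightarrow> coeff H m = 0" and u: "u * coeff H n = 1"
    and HF: "\<And>m. coeff (H * F) m \<in> J"
  shows "coeff F m \<in> J"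
proof -
  \<comment> \<open>The descent is an induction on \<open>d\<close>: for \<open>d = 0\<close> the
    coefficients in question lie above the degree and vanish.\<close>
  have "\<forall>m. degree F < m + d \<longrightarrow> coeff F m \<in> J" for d
  proof (induction d)
    case 0
    then show ?case using is_ideal_0[OF J] by (simp add: coeff_eq_0)
  next
    case (Suc d)
    show ?case
    proof (intro allI impI)
      fix m assume m: "degree F < m + Suc d"
      \<comment> \<open>Terms with \<open>i > n\<close> vanish, and those with \<open>i < n\<close>
        involve coefficients of \<open>F\<close> above index \<open>m\<close>.\<close>
      have "coeff (H * F) (m + n) = coeff H n * coeff F m + (\<Sum>i\<in>{..m + n} - {n}. coeff H i * coeff F (m + n - i))"
        by (simp add: coeff_mult sum.remove[of "{..m + n}" n])
      moreover have "(\<Sum>i\<in>{..m + n} - {n}. coeff H i * coeff F (m + n - i)) \<in> J"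
      proof (rule is_ideal_sum[OF J])
        fix i assume "i \<in> {..m + n} - {n}"
        then show "coeff H i * coeff F (m + n - i) \<in> J"
          using H[of i] Suc m is_ideal_0[OF J] by (cases "i > n") (auto intro!: is_ideal_mult[OF J])
      qed
      ultimately have "coeff H n * coeff F m \<in> J"
        using is_ideal_diff[OF J HF[of "m + n"]] by fastforce
      then have "u * (coeff H n * coeff F m) \<in> J" by (rule is_ideal_mult[OF J])
      then show "coeff F m \<in> J" using u by (simp flip: mult.assoc)
    qed
  qed
  from this[of "Suc (degree F)"] show ?thesis by simp
qed

text \<open>Translation along \<open>v\<close> fixes \<open>g\<close> and \<open>k\<close>, so every
  \<open>T\<close>-coefficient of the translated identity lies in the ideal they generate. As the
  leading coefficient of \<open>shift v h\<close> is a unit, the coefficients of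
  \<open>shift v f\<close> lie there too, among them \<open>f\<close> itself at
  \<open>T = 0\<close>.\<close>

lemma monic_along_cancel:
  fixes h f g k :: "'k::finite cpoly"
  assumes h: "monic_along v h" and g: "g \<in> invariants v" and k: "k \<in> invariants v"
    and eq: "h * f = a * g + b * k"
  shows "\<exists>a b. f = a * g + b * k"
proof -
  let ?J = "{a * g + b * k | a b. True}"
  have J: "is_ideal ?J"
  proof (rule is_idealI)
    show "0 \<in> ?J" by (intro CollectI exI[of _ 0]) simp
  next
    fix x y assume "x \<in> ?J" "y \<in> ?J"
    then obtain a b a' b' where "x = a * g + b * k" "y = a' * g + b' * k" by blast
    then have "x + y = (a + a') * g + (b + b') * k" by (simp add: algebra_simps)
    then show "x + y \<in> ?J" by blast
  next
    fix c x assume "x \<in> ?J"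
    then obtain a b where "x = a * g + b * k" by blast
    then have "c * x = (c * a) * g + (c * b) * k" by (simp add: algebra_simps)
    then show "c * x \<in> ?J" by blast
  qed
  obtain n c where c: "c \<noteq> 0" "coeff (shift v h) n = cst c" "\<And>m. m > n \<Longrightarrow> coeff (shift v h) m = 0"
    using h by (auto simp: monic_along_def)
  have "shift v h * shift v f = shift v a * [:g:] + shift v b * [:k:]"
    using g k arg_cong[OF eq, of "shift v"] by (simp add: invariants_def shift_simps)
  then have "coeff (shift v h * shift v f) m = coeff (shift v a) m * g + coeff (shift v b) m * k" for m
    by (simp add: mult.commute)
  then have "\<And>m. coeff (shift v h * shift v f) m \<in> ?J" by blast
  moreover have "cst (inverse c) * coeff (shift v h) n = 1"
    using c by (simp flip: cst_mult)
  ultimately have "coeff (shift v f) 0 \<in> ?J"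
    using coeff_in_ideal_if_mult[OF J, of n "shift v h" "cst (inverse c)" "shift v f" 0] c(3) by blast
  then show ?thesis by (simp add: coeff_shift_0)
qed


section \<open>Chains of primes above an ideal without invariants\<close>

text \<open>Hence the forms \<open>z\<^sub>k - a z\<^sub>i - b z\<^sub>j\<close> with \<open>k \<noteq> i, j\<close> vanish on \<open>v\<close> and \<open>w\<close>.\<close>

lemma ex_linear_dependence:
  fixes v w :: "complex ^ 'k::finite"
  shows "\<exists>i j. \<forall>k. \<exists>a b. v $ k = a * v $ i + b * v $ j \<and> w $ k = a * w $ i + b * w $ j"
proof (cases "\<exists>i j. v $ i * w $ j - v $ j * w $ i \<noteq> 0")
  case True
  then obtain i j where D: "v $ i * w $ j - v $ j * w $ i \<noteq> 0" by blast
  let ?D = "v $ i * w $ j - v $ j * w $ i"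
  \<comment> \<open>Cramer's rule for the nonzero minor \<open>?D\<close>.\<close>
  have "v $ k = (v $ k * w $ j - v $ j * w $ k) / ?D * v $ i + (v $ i * w $ k - v $ k * w $ i) / ?D * v $ j
      \<and> w $ k = (v $ k * w $ j - v $ j * w $ k) / ?D * w $ i + (v $ i * w $ k - v $ k * w $ i) / ?D * w $ j" for k
    using D by (auto simp: divide_simps) (auto simp: algebra_simps)
  then show ?thesis by blast
next
  case False
  then have minor: "v $ i * w $ j = v $ j * w $ i" for i j by auto
  show ?thesis
  proof (cases "\<exists>i. v $ i \<noteq> 0 \<or> w $ i \<noteq> 0")
    case False
    then show ?thesis by auto
  next
    case True
    then obtain i where i: "v $ i \<noteq> 0 \<or> w $ i \<noteq> 0" by blast
    \<comment> \<open>All minors vanish, so one index suffices and \<open>j = i\<close> is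
      taken.\<close>
    have "\<exists>a b. v $ k = a * v $ i + b * v $ i \<and> w $ k = a * w $ i + b * w $ i" for k
    proof (cases "v $ i = 0")
      case True
      with i minor[of i k] show ?thesis
        by (intro exI[of _ "w $ k / w $ i"] exI[of _ 0]) auto
    next
      case False
      with minor[of i k] show ?thesis
        by (intro exI[of _ "v $ k / v $ i"] exI[of _ 0]) (auto simp: field_simps)
    qed
    then show ?thesis by blast
  qed
qed

text \<open>\<open>E\<close> holds the indices \<open>i\<close> and \<open>j\<close> of
  \<open>ex_linear_dependence\<close>. Where these coordinates vanish, the form \<open>y k\<close>
  restricts to the coordinate \<open>z $ k\<close>; hence the \<open>y k\<close> with
  \<open>k\<close> outside \<open>E\<close> are algebraically independent.\<close>

lemma ex_invariant_coordinates:
  fixes v w :: "complex ^ 'k::finite"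
  shows "\<exists>(E :: 'k set) y. card E \<le> 2 \<and>
    (\<forall>k. y k \<in> invariants v \<and> y k \<in> invariants w \<and> Poly_Mapping.keys (y k) \<subseteq> exponent_box 1 \<and>
      (\<forall>z. (\<forall>i\<in>E. z $ i = 0) \<longrightarrow> poly_eval (y k) z = z $ k))"
proof -
  obtain i j where "\<forall>k. \<exists>a b. v $ k = a * v $ i + b * v $ j \<and> w $ k = a * w $ i + b * w $ j"
    using ex_linear_dependence by blast
  then obtain a b where ab: "\<And>k. v $ k = a k * v $ i + b k * v $ j" "\<And>k. w $ k = a k * w $ i + b k * w $ j"
    by metis
  define y where "y k = var k - cst (a k) * var i - cst (b k) * var j" for k
  have inv: "y k \<in> invariants u" if "\<And>k. u $ k = a k * u $ i + b k * u $ j" for u k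
    using arg_cong[OF that[of k], of "cst :: _ \<Rightarrow> 'k cpoly"]
    by (simp add: invariants_def y_def shift_simps single_add cst_mult algebra_simps)
  have exponent_box: "Poly_Mapping.keys (cst c * var l) \<subseteq> exponent_box 1" for c and l :: 'k
    by (auto simp: var_def mult_single exponent_box_def lookup_single when_def)
  have "Poly_Mapping.keys (y k) \<subseteq> exponent_box 1" for k
    unfolding y_def using keys_diff exponent_box[of 1 k] exponent_box[of "a k" i] exponent_box[of "b k" j]
    by (smt (verit, best) Un_iff mult_1 single_one subset_iff)
  moreover have "poly_eval (y k) z = z $ k" if "\<forall>i\<in>{i, j}. z $ i = 0" for k z
    using that by (simp add: y_def poly_eval_simps)
  moreover have "card {i, j} \<le> 2" by (simp add: card_insert_if)
  ultimately show ?thesis using inv ab by (intro exI[of _ "{i, j}"] exI[of _ y]) blast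
qed

text \<open>Modulo \<open>Q\<close> only \<open>b 0\<close> survives, and it vanishes because no
  nonzero element of \<open>B\<close> lies in \<open>Q\<close>. The rest is \<open>a\<close> times a
  shorter sum, and \<open>a\<close> can be cancelled modulo the prime \<open>P\<close>.\<close>

lemma power_sum_in_prime_ideal:
  assumes P: "prime_ideal P" and Q: "is_ideal Q" "P \<subseteq> Q" and a: "a \<in> Q" "a \<notin> P"
    and B: "\<And>x. x \<in> B \<Longrightarrow> x \<in> Q \<Longrightarrow> x = 0"
    and "\<And>i. i < n \<Longrightarrow> b i \<in> B" "(\<Sum>i<n. b i * a ^ i) \<in> P"
  shows "\<forall>i<n. b i = 0"
  using assms(7,8)
proof (induction n arbitrary: b)
  case 0
  then show ?case by simp
next
  case (Suc n)
  have eq: "(\<Sum>i<Suc n. b i * a ^ i) = b 0 + a * (\<Sum>i<n. b (Suc i) * a ^ i)"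
    by (subst sum.lessThan_Suc_shift) (simp add: sum_distrib_left algebra_simps)
  have aQ: "a * s \<in> Q" for s using is_ideal_mult[OF Q(1) a(1), of s] by (simp add: mult.commute)
  have "(b 0 + a * (\<Sum>i<n. b (Suc i) * a ^ i)) - a * (\<Sum>i<n. b (Suc i) * a ^ i) \<in> Q"
    using Suc.prems(2) Q(2) aQ unfolding eq by (intro is_ideal_diff[OF Q(1)]) auto
  then have b0: "b 0 = 0" using B Suc.prems(1)[of 0] by simp
  then have "(\<Sum>i<n. b (Suc i) * a ^ i) \<in> P"
    using Suc.prems(2) P a(2) unfolding eq prime_ideal_def by auto
  then have "\<forall>i<n. b (Suc i) = 0" by (rule Suc.IH[rotated]) (simp add: Suc.prems(1))
  with b0 show ?case by (metis less_Suc_eq_0_disj)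
qed

text \<open>On the subspace where the coordinates in \<open>E\<close> vanish, the relation becomes
  one between distinct monomials in the remaining coordinates.\<close>

lemma cpoly_monomials_independent:
  fixes y :: "'k::finite \<Rightarrow> 'k cpoly"
  assumes y: "\<And>k z. (\<forall>i\<in>E. z $ i = 0) \<Longrightarrow> poly_eval (y k) z = z $ k"
    and X: "finite X" "\<And>e i. e \<in> X \<Longrightarrow> i \<in> E \<Longrightarrow> Poly_Mapping.lookup e i = 0"
    and rel: "(\<Sum>e\<in>X. cst (c e) * (\<Prod>k\<in>UNIV. y k ^ Poly_Mapping.lookup e k)) = 0"
  shows "\<forall>e\<in>X. c e = 0"
proof -
  define p where "p = (\<Sum>e\<in>X. Poly_Mapping.single e (c e))"
  have "poly_eval p z = 0" for z
  proof -
    define z' where "z' = (\<chi> i. if i \<in> E then 0 else z $ i)"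
    have yz: "poly_eval (y k) z' = z' $ k" for k by (rule y) (simp add: z'_def)
    have "poly_eval p z = (\<Sum>e\<in>X. c e * (\<Prod>k\<in>UNIV. z $ k ^ Poly_Mapping.lookup e k))"
      by (simp add: p_def poly_eval_psubst eval_hom.psubst_sum eval_hom.psubst_single)
    also have "\<dots> = (\<Sum>e\<in>X. c e * (\<Prod>k\<in>UNIV. z' $ k ^ Poly_Mapping.lookup e k))"
      using X(2) by (intro sum.cong refl arg_cong2[where f = "(*)"] prod.cong) (auto simp: z'_def)
    also have "\<dots> = poly_eval (\<Sum>e\<in>X. cst (c e) * (\<Prod>k\<in>UNIV. y k ^ Poly_Mapping.lookup e k)) z'"
      by (simp add: poly_eval_simps yz eval_hom.psubst_prod[of "($) z'", folded poly_eval_psubst])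
    finally show ?thesis by (simp add: rel poly_eval_simps)
  qed
  then have "p = 0" using ex_poly_eval_nonzero by blast
  moreover have "Poly_Mapping.lookup p e = c e" if "e \<in> X" for e
  proof -
    have "Poly_Mapping.lookup p e = (\<Sum>x\<in>X. if x = e then c e else 0)"
      unfolding p_def lookup_sum by (intro sum.cong) (auto simp: lookup_single when_def)
    then show ?thesis using that X(1) by simp
  qed
  ultimately show ?thesis by auto
qed

text \<open>
  Along such a chain, elements \<open>a\<^sub>i \<in> P\<^sub>i - P\<^sub>i\<^sub>-\<^sub>1\<close> are algebraically independent over the
  invariants. The \<open>N + 1\<close> independent elements obtained in this way have too many monomials of degree
  below \<open>D\<close> in each of them for the space of polynomials with exponents at most \<open>L D\<close>.
\<close>

lemma no_prime_chain_above_invariants: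
  fixes v w :: "complex ^ 'k::finite"
  assumes P: "prime_ideal P0" "prime_ideal P1" "prime_ideal P2" "prime_ideal P3"
    and lt: "P0 \<subset> P1" "P1 \<subset> P2" "P2 \<subset> P3"
    and inv: "\<And>p. p \<in> P3 \<Longrightarrow> p \<in> invariants v \<Longrightarrow> p \<in> invariants w \<Longrightarrow> p = 0"
  shows False
proof -
  have I: "is_ideal P0" "is_ideal P1" "is_ideal P2" "is_ideal P3" using P by (auto simp: prime_ideal_def)
  obtain a1 a2 a3 where a: "a1 \<in> P1" "a1 \<notin> P0" "a2 \<in> P2" "a2 \<notin> P1" "a3 \<in> P3" "a3 \<notin> P2"
    using lt by blast
  obtain d1 d2 d3 where d: "Poly_Mapping.keys a1 \<subseteq> exponent_box d1" "Poly_Mapping.keys a2 \<subseteq> exponent_box d2"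
    "Poly_Mapping.keys a3 \<subseteq> exponent_box d3" using ex_keys_subset_box by metis
  obtain E :: "'k set" and y :: "'k \<Rightarrow> 'k cpoly" where E: "card E \<le> 2"
    and y: "\<And>k. y k \<in> invariants v" "\<And>k. y k \<in> invariants w" "\<And>k. Poly_Mapping.keys (y k) \<subseteq> exponent_box 1"
      "\<And>k z. (\<forall>i\<in>E. z $ i = 0) \<Longrightarrow> poly_eval (y k) z = z $ k"
    using ex_invariant_coordinates[of v w] by blast
  define N where "N = CARD('k)"
  \<comment> \<open>\<open>L * D\<close> bounds the exponents in a product of powers below
    \<open>D\<close> of the \<open>y k\<close>, \<open>a3\<close>, \<open>a2\<close> and
    \<open>a1\<close>; \<open>D\<close> exceeds \<open>(L + 1) ^ N\<close> to win the count
    below.\<close>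
  define L where "L = N + d3 + d2 + d1"
  define D where "D = (L + 1) ^ N + 1"
  define X where "X = {e :: 'k \<Rightarrow>\<^sub>0 nat. \<forall>i. Poly_Mapping.lookup e i \<in> (if i \<in> E then {0} else {..<D})}"
  have finX: "finite X" unfolding X_def by (rule finite_exponents) auto
  have cardX: "card X = D ^ (N - card E)"
  proof -
    have "card X = (\<Prod>i\<in>UNIV. if i \<in> E then 1 else D)"
      unfolding X_def card_exponents by (intro prod.cong) auto
    also have "\<dots> = D ^ card (- E)" by (simp add: prod.If_cases)
    finally show ?thesis by (simp add: N_def Compl_eq_Diff_UNIV card_Diff_subset)
  qed
  define M where "M e = (\<Prod>k\<in>UNIV. y k ^ Poly_Mapping.lookup e k)" for e
  define I4 where "I4 = {..<D} \<times> {..<D} \<times> {..<D} \<times> X"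
  define g where "g = (\<lambda>(i, j, l, e). M e * a3 ^ l * a2 ^ j * a1 ^ i)"
  have D1: "1 \<le> D" by (simp add: D_def)
  \<comment> \<open>The box has at most \<open>((L + 1) * D) ^ N < D ^ (N + 1)\<close> elements,
    while \<open>card E \<le> 2\<close> leaves at least \<open>N + 1\<close> exponents ranging
    freely below \<open>D\<close>.\<close>
  have card: "card (exponent_box (L * D) :: ('k \<Rightarrow>\<^sub>0 nat) set) < card I4"
  proof -
    have "card (exponent_box (L * D) :: ('k \<Rightarrow>\<^sub>0 nat) set) = (L * D + 1) ^ N" by (simp add: card_exponent_box N_def)
    also have "\<dots> \<le> ((L + 1) * D) ^ N" using D1 by (intro power_mono) auto
    also have "\<dots> = (L + 1) ^ N * D ^ N" by (rule power_mult_distrib)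
    also have "\<dots> < D * D ^ N" using D1 by (intro mult_strict_right_mono) (auto simp: D_def)
    also have "\<dots> \<le> D ^ (N - card E + 3)"
    proof -
      have "N + 1 \<le> N - card E + 3" using E by linarith
      then have "D ^ (N + 1) \<le> D ^ (N - card E + 3)" using D1 by (intro power_increasing)
      then show ?thesis by simp
    qed
    also have "\<dots> = card I4"
      by (simp add: I4_def card_cartesian_product cardX power_add eval_nat_numeral)
    finally show ?thesis .
  qed
  have keys: "Poly_Mapping.keys (g x) \<subseteq> exponent_box (L * D)" if x: "x \<in> I4" for x
  proof -
    obtain i j l e where ijl: "x = (i, j, l, e)" "i < D" "j < D" "l < D" "e \<in> X"
      using x by (auto simp: I4_def)
    have keys_M: "Poly_Mapping.keys (M e) \<subseteq> exponent_box (\<Sum>k\<in>UNIV. Poly_Mapping.lookup e k * 1)"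
      unfolding M_def by (intro keys_prod_box keys_power_box y)
    have "Poly_Mapping.keys (g x) \<subseteq> exponent_box ((\<Sum>k\<in>UNIV. Poly_Mapping.lookup e k * 1) + l * d3 + j * d2 + i * d1)"
      unfolding g_def ijl(1) prod.case by (rule keys_mult_box[OF keys_mult_box[OF keys_mult_box[OF keys_M keys_power_box[OF d(3)]]
        keys_power_box[OF d(2)]] keys_power_box[OF d(1)]])
    also have "\<dots> \<subseteq> exponent_box (N * D + D * d3 + D * d2 + D * d1)"
    proof (rule box_mono)
      have "Poly_Mapping.lookup e k \<le> D" for k
        using ijl(5) unfolding X_def by (auto split: if_splits dest!: spec[of _ k])
      then have "(\<Sum>k\<in>UNIV. Poly_Mapping.lookup e k * 1) \<le> N * D"
        using sum_bounded_above[of "UNIV :: 'k set" "Poly_Mapping.lookup e" D] by (simp add: N_def)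
      then show "(\<Sum>k\<in>UNIV. Poly_Mapping.lookup e k * 1) + l * d3 + j * d2 + i * d1
          \<le> N * D + D * d3 + D * d2 + D * d1"
        using ijl by (intro add_mono mult_right_mono) auto
    qed
    also have "N * D + D * d3 + D * d2 + D * d1 = L * D" by (simp add: L_def algebra_simps)
    finally show ?thesis .
  qed
  have fin: "finite I4" using finX by (simp add: I4_def)
  have "\<exists>c. (\<exists>x\<in>I4. c x \<noteq> 0) \<and> (\<Sum>x\<in>I4. cst (c x) * g x) = 0"
    by (rule ex_linear_relation[OF finite_exponent_box fin card keys])
  then obtain c where c: "\<exists>x\<in>I4. c x \<noteq> 0" "(\<Sum>x\<in>I4. cst (c x) * g x) = 0"
    by (elim exE conjE)
  define b where "b i j l = (\<Sum>e\<in>X. cst (c (i, j, l, e)) * M e)" for i j l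
  have "(\<Sum>x\<in>I4. cst (c x) * g x) =
      (\<Sum>i<D. \<Sum>j<D. \<Sum>l<D. \<Sum>e\<in>X. cst (c (i, j, l, e)) * (M e * a3 ^ l * a2 ^ j * a1 ^ i))"
    by (simp add: I4_def g_def sum.cartesian_product case_prod_beta)
  also have "\<dots> = (\<Sum>i<D. (\<Sum>j<D. (\<Sum>l<D. b i j l * a3 ^ l) * a2 ^ j) * a1 ^ i)"
    by (simp add: b_def sum_distrib_right mult.assoc)
  finally have rel: "(\<Sum>i<D. (\<Sum>j<D. (\<Sum>l<D. b i j l * a3 ^ l) * a2 ^ j) * a1 ^ i) = 0"
    using c by simp
  \<comment> \<open>\<open>B2\<close> and \<open>B1\<close> adjoin powers of \<open>a3\<close> and
    then of \<open>a2\<close> to the invariants \<open>B3\<close>. Since \<open>B3\<close> meets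
    \<open>P3\<close> only in zero, \<open>power_sum_in_prime_ideal\<close> gives the same for
    \<open>B2\<close> and \<open>P2\<close>, then for \<open>B1\<close> and \<open>P1\<close>. The
    relation is unwound in the opposite order, starting with the powers of
    \<open>a1\<close>.\<close>
  define B3 where "B3 = invariants v \<inter> invariants w"
  define B2 where "B2 = {(\<Sum>l<D. f l * a3 ^ l) | f. \<forall>l<D. f l \<in> B3}"
  define B1 where "B1 = {(\<Sum>j<D. f j * a2 ^ j) | f. \<forall>j<D. f j \<in> B2}"
  have bB: "b i j l \<in> B3" for i j l
    unfolding b_def M_def B3_def
    by (intro IntI invariants_sum invariants_mult invariants_cst invariants_prod invariants_power y)
  have i3: "x = 0" if "x \<in> B3" "x \<in> P3" for x using inv that by (simp add: B3_def)
  have r3: "\<forall>l<D. f l = 0" if "\<And>l. l < D \<Longrightarrow> f l \<in> B3" "(\<Sum>l<D. f l * a3 ^ l) \<in> P2" for f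
    using power_sum_in_prime_ideal[OF P(3) I(4) _ a(5,6), of B3 D f] i3 that lt by blast
  have i2: "x = 0" if xB: "x \<in> B2" and xP: "x \<in> P2" for x
  proof -
    obtain f where f: "x = (\<Sum>l<D. f l * a3 ^ l)" "\<forall>l<D. f l \<in> B3" using xB unfolding B2_def by blast
    then have "\<forall>l<D. f l = 0" using xP by (intro r3) auto
    then show ?thesis by (simp add: f(1))
  qed
  have r2: "\<forall>j<D. f j = 0" if "\<And>j. j < D \<Longrightarrow> f j \<in> B2" "(\<Sum>j<D. f j * a2 ^ j) \<in> P1" for f
    using power_sum_in_prime_ideal[OF P(2) I(3) _ a(3,4), of B2 D f] i2 that lt by blast
  have i1: "x = 0" if xB: "x \<in> B1" and xP: "x \<in> P1" for x
  proof -
    obtain f where f: "x = (\<Sum>j<D. f j * a2 ^ j)" "\<forall>j<D. f j \<in> B2" using xB unfolding B1_def by blast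
    then have "\<forall>j<D. f j = 0" using xP by (intro r2) auto
    then show ?thesis by (simp add: f(1))
  qed
  have bB2: "(\<Sum>l<D. b i j l * a3 ^ l) \<in> B2" for i j unfolding B2_def using bB by blast
  have bB1: "(\<Sum>j<D. (\<Sum>l<D. b i j l * a3 ^ l) * a2 ^ j) \<in> B1" for i
    unfolding B1_def by (intro CollectI exI[of _ "\<lambda>j. \<Sum>l<D. b i j l * a3 ^ l"]) (simp add: bB2)
  have e1: "\<forall>i<D. (\<Sum>j<D. (\<Sum>l<D. b i j l * a3 ^ l) * a2 ^ j) = 0"
    using power_sum_in_prime_ideal[OF P(1) I(2) _ a(1,2), of B1 D "\<lambda>i. \<Sum>j<D. (\<Sum>l<D. b i j l * a3 ^ l) * a2 ^ j"]
      i1 bB1 rel is_ideal_0[OF I(1)] lt by auto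
  have e2: "\<forall>j<D. (\<Sum>l<D. b i j l * a3 ^ l) = 0" if "i < D" for i
    using e1 that bB2 is_ideal_0[OF I(2)] by (intro r2) auto
  have e3: "\<forall>l<D. b i j l = 0" if "i < D" "j < D" for i j
    using e2 that bB is_ideal_0[OF I(3)] by (intro r3) auto
  have "c (i, j, l, e) = 0" if "i < D" "j < D" "l < D" "e \<in> X" for i j l e
  proof -
    have "\<forall>e\<in>X. c (i, j, l, e) = 0"
    proof (rule cpoly_monomials_independent[OF y(4) finX])
      show "Poly_Mapping.lookup e i = 0" if "e \<in> X" "i \<in> E" for e i
        using that by (auto simp: X_def dest!: spec[of _ i])
      show "(\<Sum>e\<in>X. cst (c (i, j, l, e)) * (\<Prod>k\<in>UNIV. y k ^ Poly_Mapping.lookup e k)) = 0"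
        using e3 that by (simp add: b_def M_def)
    qed
    then show ?thesis using that by blast
  qed
  then show False using c(1) by (auto simp: I4_def)
qed

text \<open>Take a prime \<open>P\<close> that contains \<open>I\<close> and avoids the nonzero
  invariants. Irreducible closed sets strictly increasing from \<open>zeros P\<close> correspond to
  primes strictly decreasing from \<open>P\<close>, and
  \<open>no_prime_chain_above_invariants\<close> forbids three strict steps.\<close>

lemma ex_irreducible_codim_le_2:
  fixes I :: "'k::finite cpoly set"
  assumes I: "is_ideal I" and inv: "\<And>p. p \<in> I \<Longrightarrow> p \<in> invariants v \<Longrightarrow> p \<in> invariants w \<Longrightarrow> p = 0"
  shows "\<exists>Y. irreducible_closed Y \<and> Y \<subseteq> zeros I \<and> irreducible_codim Y \<le> 2"
proof -
  define T where "T = invariants v \<inter> invariants w - {0}"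
  have "1 \<in> T" by (simp add: T_def invariants_1)
  moreover have "s * t \<in> T" if "s \<in> T" "t \<in> T" for s t
    using that by (auto simp: T_def invariants_mult cpoly_mult_eq_0_iff)
  moreover have "I \<inter> T = {}" using inv by (auto simp: T_def)
  ultimately obtain P where P: "prime_ideal P" "I \<subseteq> P" "P \<inter> T = {}"
    using ex_prime_ideal_avoiding[OF I, of T] by blast
  have "m \<le> 2" if C0: "C 0 = zeros P" and C: "\<forall>i\<le>m. irreducible_closed (C i)" "\<forall>i<m. C i \<subset> C (Suc i)"
    for m and C :: "nat \<Rightarrow> (complex ^ 'k) set"
  proof (rule ccontr)
    assume m: "\<not> m \<le> 2"
    have irr: "irreducible_closed (C i)" if "i \<le> 3" for i using C(1) m that by auto
    have lt: "vanishing (C (Suc i)) \<subset> vanishing (C i)" if "i < 3" for i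
    proof -
      have sub: "C i \<subset> C (Suc i)" using C(2) m that by auto
      have "vanishing (C (Suc i)) \<noteq> vanishing (C i)"
        using sub zeros_vanishing[of "C i"] zeros_vanishing[of "C (Suc i)"] irr[of i] irr[of "Suc i"] that
        by (auto simp: irreducible_closed_def)
      then show ?thesis using sub by (auto simp: vanishing_def)
    qed
    have "p = 0" if "p \<in> vanishing (C 0)" "p \<in> invariants v" "p \<in> invariants w" for p
      using that P(3) by (auto simp: C0 vanishing_zeros_prime[OF P(1)] T_def)
    moreover have "vanishing (C 1) \<subset> vanishing (C 0)" "vanishing (C 2) \<subset> vanishing (C 1)"
      "vanishing (C 3) \<subset> vanishing (C 2)"
      using lt[of 0] lt[of 1] lt[of 2] by (simp_all add: eval_nat_numeral)
    ultimately show False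
      using no_prime_chain_above_invariants[OF prime_ideal_vanishing[OF irr[of 3]] prime_ideal_vanishing[OF irr[of 2]]
          prime_ideal_vanishing[OF irr[of 1]] prime_ideal_vanishing[OF irr[of 0]], of v w] by simp
  qed
  then have "irreducible_codim (zeros P) \<le> enat 2"
    unfolding irreducible_codim_def by (intro Sup_least) (auto simp del: enat_ord_number)
  then have "irreducible_codim (zeros P) \<le> 2" by (simp add: numeral_eq_enat)
  moreover have "zeros P \<subseteq> zeros I" using P(2) by (auto simp: zeros_def)
  ultimately show ?thesis using irreducible_closed_zeros[OF P(1)] by blast
qed


section \<open>Division of two-forms\<close>

text \<open>
  Contracting \<open>\<omega> \<and> \<beta> = 0\<close> with \<open>\<Sum>\<^sub>i c\<^sub>r\<^sub>i \<partial>/\<partial>z\<^sub>i\<close> gives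
  \<open>h\<^sub>r \<beta> = \<omega> \<and> \<eta>\<^sub>r\<close>. By regularity \<open>h\<^sub>2 \<eta>\<^sub>3 - h\<^sub>3 \<eta>\<^sub>2 = (a h\<^sub>2 + b h\<^sub>3) \<omega>\<close>, so
  \<open>\<eta>\<^sub>2 + b \<omega>\<close> is divisible by \<open>h\<^sub>2\<close>.
\<close>

lemma division_of_two_form:
  fixes \<omega> :: "'k::finite cpoly ^ 'k" and \<beta> :: "'k \<Rightarrow> 'k \<Rightarrow> 'k cpoly"
  assumes wedge: "\<And>i j l. wedge12 \<omega> \<beta> i j l = 0"
    and h: "h1 = (\<Sum>i\<in>UNIV. c1 i * \<omega> $ i)" "h2 = (\<Sum>i\<in>UNIV. c2 i * \<omega> $ i)" "h3 = (\<Sum>i\<in>UNIV. c3 i * \<omega> $ i)"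
    and h1: "monic_along v h1" and h2: "monic_along w h2" "h2 \<in> invariants v"
    and h3: "h3 \<in> invariants v" "h3 \<in> invariants w" "h3 \<noteq> 0"
  shows "\<exists>\<eta>. \<forall>i j. \<beta> i j = \<omega> $ i * \<eta> j - \<omega> $ j * \<eta> i"
proof -
  have nz: "h1 \<noteq> 0" "h2 \<noteq> 0" using h1 h2 by (auto simp: monic_along_def shift_simps cst_eq_0_iff)
  have contract: "(\<Sum>i\<in>UNIV. c i * \<omega> $ i) * \<beta> j l
      = \<omega> $ j * (\<Sum>i\<in>UNIV. c i * \<beta> i l) - \<omega> $ l * (\<Sum>i\<in>UNIV. c i * \<beta> i j)" for c j l
  proof -
    have "(\<Sum>i\<in>UNIV. c i * \<omega> $ i) * \<beta> j l - \<omega> $ j * (\<Sum>i\<in>UNIV. c i * \<beta> i l) + \<omega> $ l * (\<Sum>i\<in>UNIV. c i * \<beta> i j)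
        = (\<Sum>i\<in>UNIV. c i * wedge12 \<omega> \<beta> i j l)"
      by (simp add: wedge12_def sum_distrib_left sum_distrib_right algebra_simps sum.distrib sum_subtractf)
    also have "\<dots> = 0" by (simp add: wedge)
    finally show ?thesis by (simp add: algebra_simps)
  qed
  define \<eta>1 where "\<eta>1 l = (\<Sum>i\<in>UNIV. c1 i * \<beta> i l)" for l
  define \<eta>2 where "\<eta>2 l = (\<Sum>i\<in>UNIV. c2 i * \<beta> i l)" for l
  define \<eta>3 where "\<eta>3 l = (\<Sum>i\<in>UNIV. c3 i * \<beta> i l)" for l
  have e1: "h1 * \<beta> j l = \<omega> $ j * \<eta>1 l - \<omega> $ l * \<eta>1 j" for j l
    unfolding h \<eta>1_def by (rule contract)
  have e2: "h2 * \<beta> j l = \<omega> $ j * \<eta>2 l - \<omega> $ l * \<eta>2 j" for j l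
    unfolding h \<eta>2_def by (rule contract)
  have e3: "h3 * \<beta> j l = \<omega> $ j * \<eta>3 l - \<omega> $ l * \<eta>3 j" for j l
    unfolding h \<eta>3_def by (rule contract)
  \<comment> \<open>\<open>h2\<close> is monic along \<open>w\<close> and \<open>h3\<close> is
    invariant along \<open>w\<close>, so \<open>h2\<close> is regular modulo \<open>h3\<close>; the
    second generator is set to \<open>0\<close>.\<close>
  have reg2: "\<exists>g. f = g * h3" if "h2 * f = h3 * g" for f g
    using monic_along_cancel[OF h2(1) h3(2) invariants_0, of f g 0] that by (auto simp: mult.commute)
  have reg2': "\<exists>g. f = g * h2" if eq: "h3 * f = h2 * g" for f g
  proof -
    obtain k where k: "g = k * h3" using reg2[OF eq[symmetric]] by blast
    have "h3 * f = h3 * (k * h2)" unfolding eq k by (simp add: algebra_simps)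
    then show ?thesis using h3(3) by (auto simp: cpoly_mult_left_cancel)
  qed
  have reg3: "\<exists>a b. f = a * h2 + b * h3" if "h1 * f = a * h2 + b * h3" for f a b
    using monic_along_cancel[OF h1 h2(2) h3(1) that] .
  show ?thesis
  proof (cases "\<omega> = 0")
    case True
    then have "\<beta> i j = 0" for i j using e1[of i j] nz by (simp add: cpoly_mult_eq_0_iff)
    with True show ?thesis by auto
  next
    case False
    then obtain s where s: "\<omega> $ s \<noteq> 0" by (auto simp: vec_eq_iff)
    \<comment> \<open>A form proportional to \<open>\<omega>\<close> is a polynomial multiple of it:
      the fractions \<open>u2 / h2\<close> and \<open>u3 / h3\<close> agree, and by
      \<open>reg2\<close> their common value is a polynomial.\<close>
    have div1: "\<exists>f. \<forall>l. \<alpha> l = f * \<omega> $ l"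
      if \<alpha>: "\<And>j l. \<omega> $ j * \<alpha> l = \<omega> $ l * \<alpha> j" for \<alpha>
    proof -
      have u: "(\<Sum>i\<in>UNIV. c i * \<omega> $ i) * \<alpha> l = (\<Sum>i\<in>UNIV. c i * \<alpha> i) * \<omega> $ l" for c l
        by (simp add: sum_distrib_right mult.assoc \<alpha>[of _ l]) (simp add: algebra_simps)
      define u2 where "u2 = (\<Sum>i\<in>UNIV. c2 i * \<alpha> i)"
      define u3 where "u3 = (\<Sum>i\<in>UNIV. c3 i * \<alpha> i)"
      have u2: "h2 * \<alpha> l = u2 * \<omega> $ l" and u3: "h3 * \<alpha> l = u3 * \<omega> $ l" for l
        using u by (simp_all add: h u2_def u3_def)
      have "\<omega> $ s * (h2 * u3) = h2 * (h3 * \<alpha> s)" by (simp add: u3 algebra_simps)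
      also have "\<dots> = h3 * (h2 * \<alpha> s)" by (simp add: algebra_simps)
      also have "\<dots> = \<omega> $ s * (h3 * u2)" by (simp add: u2 algebra_simps)
      finally have "h2 * u3 = h3 * u2" using s by (simp add: cpoly_mult_left_cancel)
      then obtain f where f: "u3 = f * h3" using reg2 by blast
      have "h3 * \<alpha> l = h3 * (f * \<omega> $ l)" for l unfolding u3 f by (simp add: algebra_simps)
      then have "\<alpha> l = f * \<omega> $ l" for l using h3(3) by (simp add: cpoly_mult_left_cancel)
      then show ?thesis by blast
    qed
    \<comment> \<open>\<open>\<theta> / x\<close> and \<open>\<theta>' / x'\<close> both divide
      \<open>\<beta>\<close> by \<open>\<omega>\<close>, so their cross-multiplied difference is
      proportional to \<open>\<omega>\<close>.\<close>
    have syz: "\<exists>f. \<forall>l. x * \<theta>' l - x' * \<theta> l = f * \<omega> $ l"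
      if "\<And>j l. x * \<beta> j l = \<omega> $ j * \<theta> l - \<omega> $ l * \<theta> j" "\<And>j l. x' * \<beta> j l = \<omega> $ j * \<theta>' l - \<omega> $ l * \<theta>' j" for x x' \<theta> \<theta>'
    proof (rule div1)
      fix j l
      have "x * (x' * \<beta> j l) = x' * (x * \<beta> j l)" by (simp add: algebra_simps)
      then show "\<omega> $ j * (x * \<theta>' l - x' * \<theta> l) = \<omega> $ l * (x * \<theta>' j - x' * \<theta> j)"
        unfolding that by (simp add: algebra_simps)
    qed
    obtain f23 where f23: "\<And>l. h2 * \<eta>3 l - h3 * \<eta>2 l = f23 * \<omega> $ l" using syz[OF e2 e3] by blast
    obtain f13 where f13: "\<And>l. h1 * \<eta>3 l - h3 * \<eta>1 l = f13 * \<omega> $ l" using syz[OF e1 e3] by blast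
    obtain f12 where f12: "\<And>l. h1 * \<eta>2 l - h2 * \<eta>1 l = f12 * \<omega> $ l" using syz[OF e1 e2] by blast
    \<comment> \<open>A Koszul-type identity links the three comparisons and puts
      \<open>h1 * f23\<close> into the ideal of \<open>h2\<close> and \<open>h3\<close>;
      \<open>reg3\<close> then removes \<open>h1\<close>.\<close>
    have "\<omega> $ s * (h1 * f23) = h1 * (h2 * \<eta>3 s - h3 * \<eta>2 s)" unfolding f23 by (simp add: algebra_simps)
    also have "\<dots> = h2 * (h1 * \<eta>3 s - h3 * \<eta>1 s) - h3 * (h1 * \<eta>2 s - h2 * \<eta>1 s)"
      by (simp add: algebra_simps)
    also have "\<dots> = \<omega> $ s * (f13 * h2 + (- f12) * h3)" unfolding f13 f12 by (simp add: algebra_simps)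
    finally have "h1 * f23 = f13 * h2 + (- f12) * h3" using s by (simp only: cpoly_mult_left_cancel simp_thms)
    then obtain a b where ab: "f23 = a * h2 + b * h3" using reg3 by blast
    define \<eta> where "\<eta> l = \<eta>2 l + b * \<omega> $ l" for l
    have "h3 * \<eta> l = h2 * (\<eta>3 l - a * \<omega> $ l)" for l
      using f23[of l] unfolding ab \<eta>_def by (simp add: algebra_simps)
    then have "\<exists>g. \<eta> l = g * h2" for l using reg2' by blast
    then obtain \<theta> where \<theta>: "\<And>l. \<eta> l = \<theta> l * h2" by metis
    have "h2 * \<beta> j l = h2 * (\<omega> $ j * \<theta> l - \<omega> $ l * \<theta> j)" for j l
    proof -
      have "h2 * \<beta> j l = \<omega> $ j * \<eta> l - \<omega> $ l * \<eta> j" unfolding e2 \<eta>_def by (simp add: algebra_simps)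
      then show ?thesis unfolding \<theta> by (simp add: algebra_simps)
    qed
    then show ?thesis using nz(2) by (auto simp: cpoly_mult_left_cancel)
  qed
qed


section \<open>Contraction with radial vector fields\<close>

text \<open>Only the monomial one higher than \<open>e\<close> in the variable \<open>i\<close>
  contributes; in this form no truncated subtraction remains.\<close>

lemma lookup_partial:
  "Poly_Mapping.lookup (partial i p) e =
    (of_nat (Poly_Mapping.lookup e i) + 1) * Poly_Mapping.lookup p (e + Poly_Mapping.single i 1)"
  for e :: "'k \<Rightarrow>\<^sub>0 nat"
proof -
  let ?s = "Poly_Mapping.single i (1 :: nat)"
  let ?r = "(of_nat (Poly_Mapping.lookup e i) + 1) * Poly_Mapping.lookup p (e + ?s)"
  have "Poly_Mapping.lookup (Poly_Mapping.single (x - ?s)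
      (of_nat (Poly_Mapping.lookup x i) * Poly_Mapping.lookup p x)) e = (if x = e + ?s then ?r else 0)" for x
  proof (cases "Poly_Mapping.lookup x i = 0")
    case True
    then have "x \<noteq> e + ?s" by (auto simp: lookup_add)
    with True show ?thesis by simp
  next
    case False
    have "x - ?s = e \<longleftrightarrow> x = e + ?s"
    proof
      assume "x - ?s = e"
      moreover have "x = (x - ?s) + ?s"
        using False by (intro poly_mapping_eqI) (auto simp: lookup_add lookup_minus lookup_single when_def)
      ultimately show "x = e + ?s" by simp
    qed simp
    then show ?thesis by (simp add: lookup_single when_def lookup_add)
  qed
  then have "Poly_Mapping.lookup (partial i p) e = (\<Sum>x\<in>Poly_Mapping.keys p. if x = e + ?s then ?r else 0)"
    by (simp add: partial_def lookup_sum)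
  then show ?thesis by (auto simp: in_keys_iff)
qed

lemma partial_add: "partial i (p + q) = partial i p + partial i q"
  by (rule poly_mapping_eqI) (simp add: lookup_partial lookup_add algebra_simps)

lemma partial_sum: "partial i (\<Sum>x\<in>X. f x) = (\<Sum>x\<in>X. partial i (f x))"
proof (induction X rule: infinite_finite_induct)
  case (insert x X)
  then show ?case by (simp add: partial_add)
qed (simp_all add: partial_def)

lemma partial_cst_mult: "partial i (cst c * p) = cst c * partial i p"
  by (rule poly_mapping_eqI) (simp add: lookup_partial lookup_cst_mult)

lemma lookup_var_mult:
  "Poly_Mapping.lookup (var i * p) e =
    (if Poly_Mapping.lookup e i = 0 then 0 else Poly_Mapping.lookup p (e - Poly_Mapping.single i 1))"
  for e :: "'k \<Rightarrow>\<^sub>0 nat"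
proof -
  let ?s = "Poly_Mapping.single i (1 :: nat)"
  let ?r = "if Poly_Mapping.lookup e i = 0 then 0 else Poly_Mapping.lookup p (e - ?s)"
  have "var i * p = var i * (\<Sum>x\<in>Poly_Mapping.keys p. Poly_Mapping.single x (Poly_Mapping.lookup p x))"
    by (simp only: cpoly_sum_single)
  also have "\<dots> = (\<Sum>x\<in>Poly_Mapping.keys p. Poly_Mapping.single (?s + x) (Poly_Mapping.lookup p x))"
    by (simp add: var_def sum_distrib_left mult_single)
  finally have eq: "var i * p = (\<Sum>x\<in>Poly_Mapping.keys p. Poly_Mapping.single (?s + x) (Poly_Mapping.lookup p x))" .
  have "Poly_Mapping.lookup (Poly_Mapping.single (?s + x) (Poly_Mapping.lookup p x)) e
      = (if x = e - ?s then ?r else 0)" for x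
  proof (cases "Poly_Mapping.lookup e i = 0")
    case True
    then have "e \<noteq> ?s + x" by (auto simp: lookup_add)
    with True show ?thesis by (auto simp: lookup_single when_def)
  next
    case False
    then have "e = ?s + (e - ?s)"
      by (intro poly_mapping_eqI) (auto simp: lookup_add lookup_minus lookup_single when_def)
    then have "?s + x = e \<longleftrightarrow> x = e - ?s" by (metis add_left_cancel)
    with False show ?thesis by (simp add: lookup_single when_def)
  qed
  then have "Poly_Mapping.lookup (var i * p) e = (\<Sum>x\<in>Poly_Mapping.keys p. if x = e - ?s then ?r else 0)"
    by (simp add: eq lookup_sum)
  then show ?thesis by (auto simp: in_keys_iff)
qed

lemma partial_var_mult: "partial l (var i * p) = var i * partial l p + (if i = l then p else 0)"
proof (rule poly_mapping_eqI)
  fix e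
  show "Poly_Mapping.lookup (partial l (var i * p)) e
      = Poly_Mapping.lookup (var i * partial l p + (if i = l then p else 0)) e"
  proof (cases "Poly_Mapping.lookup e i = 0")
    case True
    then show ?thesis
      by (auto simp: lookup_partial lookup_var_mult lookup_add lookup_single)
  next
    case False
    have "e - Poly_Mapping.single i 1 + Poly_Mapping.single l 1 = e + Poly_Mapping.single l 1 - Poly_Mapping.single i 1"
      using False by (intro poly_mapping_eqI) (auto simp: lookup_add lookup_minus lookup_single when_def)
    with False show ?thesis
      by (auto simp: lookup_partial lookup_var_mult lookup_add lookup_minus lookup_single of_nat_diff distrib_right left_diff_distrib)
  qed
qed

lemma lookup_var_mult_partial:
  "Poly_Mapping.lookup (var i * partial i p) e = of_nat (Poly_Mapping.lookup e i) * Poly_Mapping.lookup p e"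
  for e :: "'k \<Rightarrow>\<^sub>0 nat"
proof (cases "Poly_Mapping.lookup e i = 0")
  case False
  then have "e - Poly_Mapping.single i 1 + Poly_Mapping.single i 1 = e"
    by (intro poly_mapping_eqI) (auto simp: lookup_add lookup_minus lookup_single when_def)
  with False show ?thesis
    by (simp add: lookup_var_mult lookup_partial lookup_minus of_nat_diff)
qed (simp add: lookup_var_mult)

lemma contract_diag_altdef: "contract_diag a \<omega> = (\<Sum>i\<in>UNIV. cst (a $ i) * (var i * \<omega> $ i))"
  unfolding contract_diag_def by (simp add: var_def mult_single flip: mult.assoc)

text \<open>Cartan's formula for \<open>i\<^sub>R \<omega> = 0\<close>: \<open>i\<^sub>R d\<omega> = L\<^sub>R \<omega> = c \<omega>\<close>.\<close>

lemma contract_ext_deriv: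
  fixes \<omega> :: "'k::finite cpoly ^ 'k"
  assumes contr: "contract_diag a \<omega> = 0"
    and weight: "\<And>l e. e \<in> Poly_Mapping.keys (\<omega> $ l) \<Longrightarrow>
      (\<Sum>i\<in>UNIV. a $ i * of_nat (Poly_Mapping.lookup e i)) + a $ l = c"
  shows "(\<Sum>i\<in>UNIV. cst (a $ i) * (var i * ext_deriv \<omega> i l)) = cst c * \<omega> $ l"
proof -
  \<comment> \<open>The vanishing contraction is differentiated with respect to the variable
    \<open>l\<close>.\<close>
  have "partial l (contract_diag a \<omega>) =
      (\<Sum>i\<in>UNIV. cst (a $ i) * (var i * partial l (\<omega> $ i)) + (if i = l then cst (a $ l) * \<omega> $ l else 0))"
    unfolding contract_diag_altdef partial_sum partial_cst_mult partial_var_mult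
    by (intro sum.cong) (auto simp: algebra_simps)
  then have deriv: "(\<Sum>i\<in>UNIV. cst (a $ i) * (var i * partial l (\<omega> $ i))) = - (cst (a $ l) * \<omega> $ l)"
    unfolding contr by (simp add: sum.distrib partial_def eq_neg_iff_add_eq_0)
  \<comment> \<open>By \<open>weight\<close>, all monomials of \<open>\<omega> $ l\<close> have the
    same eigenvalue \<open>c - a $ l\<close> under the radial field.\<close>
  have euler: "(\<Sum>i\<in>UNIV. cst (a $ i) * (var i * partial i (\<omega> $ l))) + cst (a $ l) * \<omega> $ l = cst c * \<omega> $ l"
  proof (rule poly_mapping_eqI)
    fix e
    have "Poly_Mapping.lookup ((\<Sum>i\<in>UNIV. cst (a $ i) * (var i * partial i (\<omega> $ l))) + cst (a $ l) * \<omega> $ l) e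
        = ((\<Sum>i\<in>UNIV. a $ i * of_nat (Poly_Mapping.lookup e i)) + a $ l) * Poly_Mapping.lookup (\<omega> $ l) e"
      by (simp add: lookup_add lookup_sum lookup_cst_mult lookup_var_mult_partial sum_distrib_right
          distrib_right mult.assoc)
    also have "\<dots> = c * Poly_Mapping.lookup (\<omega> $ l) e"
      using weight[of e l] by (cases "e \<in> Poly_Mapping.keys (\<omega> $ l)") (auto simp: in_keys_iff)
    finally show "Poly_Mapping.lookup ((\<Sum>i\<in>UNIV. cst (a $ i) * (var i * partial i (\<omega> $ l))) + cst (a $ l) * \<omega> $ l) e
        = Poly_Mapping.lookup (cst c * \<omega> $ l) e" by (simp add: lookup_cst_mult)
  qed
  have "(\<Sum>i\<in>UNIV. cst (a $ i) * (var i * ext_deriv \<omega> i l))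
      = (\<Sum>i\<in>UNIV. cst (a $ i) * (var i * partial i (\<omega> $ l))) - (\<Sum>i\<in>UNIV. cst (a $ i) * (var i * partial l (\<omega> $ i)))"
    by (simp add: ext_deriv_def right_diff_distrib sum_subtractf)
  then show ?thesis unfolding deriv using euler by simp
qed

text \<open>The exponent vector of a monomial of \<open>\<omega> $ l\<close>, with
  \<open>dz_l\<close> counted like \<open>z_l\<close>, differs from \<open>d\<close> by the divisor
  of a character. Elements of \<open>lie_cox_group u\<close> pair to zero with such divisors, so
  only the weight of \<open>d\<close> remains.\<close>

lemma section_weight:
  fixes u :: "'k::finite \<Rightarrow> int ^ 'n::finite"
  assumes "\<omega> \<in> form_sections u d" "a \<in> lie_cox_group u" "e \<in> Poly_Mapping.keys (\<omega> $ l)"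
  shows "(\<Sum>i\<in>UNIV. a $ i * of_nat (Poly_Mapping.lookup e i)) + a $ l = (\<Sum>i\<in>UNIV. a $ i * of_int (d $ i))"
proof -
  interpret N: normal "range (char_div u)" "inv_divisors :: (int ^ 'k) monoid"
    by (rule normal_char_div)
  interpret Q: group "class_group u" unfolding class_group_def by (rule N.factorgroup_is_group)
  have hom: "div_class u \<in> hom inv_divisors (class_group u)"
    using N.r_coset_hom_Mod by (simp add: class_group_def div_class_def[abs_def])
  have carr: "div_class u x \<in> carrier (class_group u)" for x
    using hom_in_carrier[OF hom, of x] by (simp add: inv_divisors_def)
  have add: "div_class u (x + y) = div_class u x \<otimes>\<^bsub>class_group u\<^esub> div_class u y" for x y
    using hom_mult[OF hom, of x y] by (simp add: inv_divisors_def)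
  define x :: "int ^ 'k" where "x = (\<chi> i. int (Poly_Mapping.lookup e i))"
  have "div_class u x = div_class u d \<otimes>\<^bsub>class_group u\<^esub> inv\<^bsub>class_group u\<^esub> div_class u (prime_div l)"
    using assms(1,3) by (auto simp: form_sections_def graded_part_def monomial_degree_def x_def)
  then have "div_class u (x + prime_div l) = div_class u d"
    by (simp add: add carr Q.m_assoc Q.l_inv)
  then obtain m where "x + prime_div l - d = char_div u m" unfolding div_class_eq_iff by blast
  then have x: "x + prime_div l = d + char_div u m" by (simp add: algebra_simps)
  have char: "(\<Sum>i\<in>UNIV. a $ i * of_int (pairing m (u i))) = 0"
  proof -
    have "(\<Sum>i\<in>UNIV. a $ i * of_int (pairing m (u i)))
        = (\<Sum>i\<in>UNIV. \<Sum>l\<in>UNIV. of_int (m $ l) * (a $ i * of_int (u i $ l)))"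
      by (simp add: pairing_def sum_distrib_left algebra_simps)
    also have "\<dots> = (\<Sum>l\<in>UNIV. of_int (m $ l) * (\<Sum>i\<in>UNIV. a $ i * of_int (u i $ l)))"
      by (subst sum.swap) (simp add: sum_distrib_left)
    finally show ?thesis using assms(2) by (simp add: lie_cox_group_iff)
  qed
  have "(\<Sum>i\<in>UNIV. a $ i * of_nat (Poly_Mapping.lookup e i)) + a $ l
      = (\<Sum>i\<in>UNIV. a $ i * of_int ((x + prime_div l) $ i))"
    by (simp add: x_def prime_div_def axis_def distrib_left sum.distrib if_distrib[of of_int]
        if_distrib[of "(*) _"] cong: if_cong)
  also have "\<dots> = (\<Sum>i\<in>UNIV. a $ i * of_int (d $ i))"
    unfolding x by (simp add: char_div_def distrib_left sum.distrib char)
  finally show ?thesis .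
qed


section \<open>Existence of a component of codimension two\<close>

lemma no_division_of_ext_deriv:
  fixes \<omega> :: "'k::finite cpoly ^ 'k"
  assumes "\<omega> \<noteq> 0" and contr: "contract_diag a \<omega> = 0" and "c \<noteq> 0"
    and cartan: "\<And>l. (\<Sum>i\<in>UNIV. cst (a $ i) * (var i * ext_deriv \<omega> i l)) = cst c * \<omega> $ l"
    and \<eta>: "\<And>i j. ext_deriv \<omega> i j = \<omega> $ i * \<eta> j - \<omega> $ j * \<eta> i"
  shows False
proof -
  obtain s where s: "\<omega> $ s \<noteq> 0" using \<open>\<omega> \<noteq> 0\<close> by (auto simp: vec_eq_iff)
  define r where "r = (\<Sum>i\<in>UNIV. cst (a $ i) * (var i * \<eta> i))"
  have "cst c * \<omega> $ s = contract_diag a \<omega> * \<eta> s - \<omega> $ s * r"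
    unfolding cartan[symmetric] contract_diag_altdef r_def \<eta>
    by (simp add: sum_distrib_left sum_distrib_right algebra_simps sum_subtractf)
  then have "\<omega> $ s * (cst c + r) = 0" by (simp add: contr algebra_simps)
  then have "cst c + r = 0" using s by (simp add: cpoly_mult_eq_0_iff)
  \<comment> \<open>The radial field vanishes at the origin, hence so does its contraction
    \<open>r\<close> with \<open>\<eta>\<close>.\<close>
  then have "poly_eval (cst c + r) 0 = 0" by (simp add: poly_eval_simps)
  then show False using \<open>c \<noteq> 0\<close> by (simp add: r_def poly_eval_simps)
qed

lemma ex_singular_irreducible_codim_le_2:
  fixes \<omega> :: "'k::finite cpoly ^ 'k"
  assumes "\<omega> \<noteq> 0" and "integrable_form \<omega>"
    and "\<And>\<eta>. \<not> (\<forall>i j. ext_deriv \<omega> i j = \<omega> $ i * \<eta> j - \<omega> $ j * \<eta> i)"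
  shows "\<exists>Y. irreducible_closed Y \<and> Y \<subseteq> singular_set \<omega> \<and> irreducible_codim Y \<le> 2"
proof (rule ccontr)
  assume none: "\<not> ?thesis"
  define I where "I = {(\<Sum>i\<in>UNIV. c i * \<omega> $ i) | c. True}"
  have I: "is_ideal I"
  proof (rule is_idealI)
    show "0 \<in> I" unfolding I_def by (intro CollectI exI[of _ "\<lambda>_. 0"]) simp
  next
    fix x y assume "x \<in> I" "y \<in> I"
    then obtain c c' where "x = (\<Sum>i\<in>UNIV. c i * \<omega> $ i)" "y = (\<Sum>i\<in>UNIV. c' i * \<omega> $ i)"
      unfolding I_def by blast
    then have "x + y = (\<Sum>i\<in>UNIV. (c i + c' i) * \<omega> $ i)" by (simp add: distrib_right sum.distrib)
    then show "x + y \<in> I" unfolding I_def by (intro CollectI exI[of _ "\<lambda>i. c i + c' i"]) simp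
  next
    fix b x assume "x \<in> I"
    then obtain c where "x = (\<Sum>i\<in>UNIV. c i * \<omega> $ i)" unfolding I_def by blast
    then have "b * x = (\<Sum>i\<in>UNIV. (b * c i) * \<omega> $ i)" by (simp add: sum_distrib_left mult.assoc)
    then show "b * x \<in> I" unfolding I_def by (intro CollectI exI[of _ "\<lambda>i. b * c i"]) simp
  qed
  have mem: "\<omega> $ s \<in> I" for s
  proof -
    have "\<omega> $ s = (\<Sum>i\<in>UNIV. (if i = s then 1 else 0) * \<omega> $ i)"
      by (simp add: if_distrib[of "\<lambda>x. x * _"] cong: if_cong)
    then show ?thesis unfolding I_def by (intro CollectI exI[of _ "\<lambda>i. if i = s then 1 else 0"]) simp
  qed
  then have sub: "zeros I \<subseteq> singular_set \<omega>" by (auto simp: zeros_def singular_set_def)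
  have inv: "\<exists>p\<in>I. p \<in> invariants v \<and> p \<in> invariants w \<and> p \<noteq> 0" for v w
  proof (rule ccontr)
    assume "\<not> ?thesis"
    then have "\<exists>Y. irreducible_closed Y \<and> Y \<subseteq> zeros I \<and> irreducible_codim Y \<le> 2"
      by (intro ex_irreducible_codim_le_2[OF I, of v w]) auto
    with sub none show False by (meson order_trans)
  qed
  obtain s where s: "\<omega> $ s \<noteq> 0" using \<open>\<omega> \<noteq> 0\<close> by (auto simp: vec_eq_iff)
  \<comment> \<open>The choices depend on one another in turn: \<open>v\<close> on a coefficient of
    \<open>\<omega>\<close>, \<open>h2\<close> on \<open>v\<close>, \<open>w\<close> on
    \<open>h2\<close>, and \<open>h3\<close> on \<open>v\<close> and \<open>w\<close>. For
    \<open>h2\<close> the direction \<open>v\<close> is used twice, as invariance is required along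
    \<open>v\<close> only.\<close>
  obtain v where v: "monic_along v (\<omega> $ s)" using ex_monic_along[OF s] by blast
  obtain h2 where h2: "h2 \<in> I" "h2 \<in> invariants v" "h2 \<noteq> 0" using inv[of v v] by blast
  obtain w where w: "monic_along w h2" using ex_monic_along[OF h2(3)] by blast
  obtain h3 where h3: "h3 \<in> I" "h3 \<in> invariants v" "h3 \<in> invariants w" "h3 \<noteq> 0"
    using inv[of v w] by blast
  obtain c1 c2 c3 where c: "\<omega> $ s = (\<Sum>i\<in>UNIV. c1 i * \<omega> $ i)" "h2 = (\<Sum>i\<in>UNIV. c2 i * \<omega> $ i)"
    "h3 = (\<Sum>i\<in>UNIV. c3 i * \<omega> $ i)" using mem[of s] h2(1) h3(1) unfolding I_def by blast
  have "wedge12 \<omega> (ext_deriv \<omega>) i j l = 0" for i j l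
    using assms(2) by (simp add: integrable_form_def)
  from division_of_two_form[OF this c v w h2(2) h3(2-4)] assms(3) show False by blast
qed

text \<open>Every irreducible closed subset of \<open>V\<close> has codimension at least two, so
  that of \<open>Y\<close> is exactly two. If such a subset \<open>Z\<close> strictly contained
  \<open>Y\<close>, prefixing \<open>Y\<close> to a chain of length at least two from
  \<open>Z\<close> would give \<open>Y\<close> codimension at least three.\<close>

lemma irreducible_component_of_min_codim:
  assumes codim: "zariski_codim V > 1" and Y: "irreducible_closed Y" "Y \<subseteq> V" "irreducible_codim Y \<le> 2"
  shows "irreducible_component Y V" and "irreducible_codim Y = 2"
proof -
  have gt: "irreducible_codim Z > 1" if "irreducible_closed Z" "Z \<subseteq> V" for Z
  proof -
    have "zariski_codim V \<le> irreducible_codim Z"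
      unfolding zariski_codim_def using that by (intro Inf_lower) blast
    then show ?thesis using codim by (rule less_le_trans[rotated])
  qed
  have enat: "2 \<le> n" if "1 < n" for n :: enat
    using ileI1[OF that] by (simp add: one_enat_def numeral_eq_enat eSuc_enat numeral_2_eq_2)
  show "irreducible_codim Y = 2" using enat[OF gt[OF Y(1,2)]] Y(3) by (rule antisym[rotated])
  show "irreducible_component Y V"
    unfolding irreducible_component_def
  proof (intro conjI allI impI Y(1,2))
    fix Z assume Z: "irreducible_closed Z \<and> Y \<subseteq> Z \<and> Z \<subseteq> V"
    show "Z = Y"
    proof (rule ccontr)
      assume "Z \<noteq> Y"
      then have lt: "Y \<subset> Z" using Z by blast
      have "1 < irreducible_codim Z" using gt Z by blast
      then obtain m C where m: "1 < enat m" and C: "C (0::nat) = Z"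
        "\<forall>i\<le>m. irreducible_closed (C i)" "\<forall>i<m. C i \<subset> C (Suc i)"
        unfolding irreducible_codim_def less_Sup_iff by blast
      define C' where "C' i = (case i of 0 \<Rightarrow> Y | Suc j \<Rightarrow> C j)" for i
      have "C' 0 = Y \<and> (\<forall>i\<le>Suc m. irreducible_closed (C' i)) \<and> (\<forall>i<Suc m. C' i \<subset> C' (Suc i))"
        using C lt Y(1) by (auto simp: C'_def split: nat.split)
      then have "enat (Suc m) \<le> irreducible_codim Y"
        unfolding irreducible_codim_def by (intro Sup_upper) blast
      then have "enat (Suc m) \<le> enat 2" using Y(3) unfolding numeral_eq_enat by (rule order_trans)
      then show False using m by (simp add: one_enat_def)
    qed
  qed
qed

theorem proposition3p1:
  fixes \<Delta> :: "(real ^ 'n) set set"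
    and \<rho> :: "'k::finite \<Rightarrow> (real ^ 'n) set"
    and u :: "'k \<Rightarrow> int ^ 'n"
    and d :: "int ^ 'k"
    and \<omega> :: "'k cpoly ^ 'k"
    and a :: "complex ^ 'k"
  assumes "complete_fan \<Delta>" and "simplicial_fan \<Delta>" and "ray_generators \<Delta> \<rho> u"
    and "cartier_divisor \<Delta> \<rho> u d"
    and "\<omega> \<in> form_sections u d" and "\<omega> \<noteq> 0" and "integrable_form \<omega>"
    and "zariski_codim (singular_set \<omega>) > 1"
    and "a \<in> radial_coeffs u" and "(\<Sum>i\<in>UNIV. a $ i * of_int (d $ i)) \<noteq> 0"
  shows "\<exists>Y. irreducible_component Y (singular_set \<omega>) \<and> irreducible_codim Y = 2"
proof -
  have a: "a \<in> lie_cox_group u" using assms(9) by (simp add: lie_cox_group_eq_radial_coeffs)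
  have contr: "contract_diag a \<omega> = 0" using assms(5) a by (auto simp: form_sections_def)
  \<comment> \<open>\<open>section_weight\<close> identifies the constant in Cartan's formula as the
    sum assumed to be nonzero, so division of the exterior derivative by \<open>\<omega>\<close>
    fails.\<close>
  have "\<not> (\<forall>i j. ext_deriv \<omega> i j = \<omega> $ i * \<eta> j - \<omega> $ j * \<eta> i)" for \<eta>
    using no_division_of_ext_deriv[OF assms(6) contr assms(10)
        contract_ext_deriv[OF contr section_weight[OF assms(5) a]]] by blast
  from ex_singular_irreducible_codim_le_2[OF assms(6,7) this]
  show ?thesis using irreducible_component_of_min_codim[OF assms(8)] by blast
qed

end
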